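(* Let $p,q\ge0$ be integers with $q$ even, let $\Omega$ be a complex symmetric $p\times p$ matrix with positive definite imaginary part, and let $D$ be a lattice in $\mathbb R^p\times(\mathbb R^p)^*\times\mathbb Z^q\times\mathbb T^q$, the isomorphic image of $\mathbb Z^{d}$, $d=2p+q$, under an embedding $\Phi$ (see context). Let $$f(s,n)=\exp\Big[\pi i\sum_{j,k=1}^ps_j\Omega_{jk}s_k-\frac{\pi}{2}\sum_{i=1}^{q/2}\big(n_i^2+n_{\frac q2+i}^2\big)\Big],\qquad (s,n)\in\mathbb R^p\times\mathbb Z^q,$$ and define the quantum theta function $\hat\Theta_D$ by $$\frac{1}{\sqrt{2^p\det(\operatorname{Im}\Omega)}}\,\hat\Theta_D={}_D\langle f,f\rangle .$$ Then $$\hat\Theta_D=\sum_{h\in D}\widetilde b_h\,e^{-\frac{\pi}{2}H(\underline{w_h},\underline{w_h})}\,e_{D,\alpha}(h),$$ where for $h=(w_{h1},w_{h2},m,r)\in D$: $\underline{w_h}=\Omega w_{h1}+w_{h2}$, $H(\underline{w_h},\underline{w_h})=\underline{w_h}^{\,t}(\operatorname{Im}\Omega)^{-1}\overline{\underline{w_h}}$, and $$\widetilde b_h=\prod_{j=1}^qb_{r_j,m_j},\qquad b_{r_j,m_j}=e^{-\frac{\pi}{2}m_j^2-\pi i m_jr_j}\,\theta\big(\tau=i,\;z=-r_j+\tfrac{i m_j}{2}\big).$$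
   Context: Lattice. $\Phi$ is a real $(2p+2q)\times d$ matrix, $d=2p+q$, whose rows $2p+1,\dots,2p+q$ have integer entries; it maps $\mathbb Z^d$ to $\mathbb R^p\times(\mathbb R^p)^*\times\mathbb Z^q\times\mathbb R^q$ and, after reducing the last $q$ coordinates mod $1$, is injective with image a lattice (discrete cocompact subgroup) $D$ in $\mathbb R^p\times(\mathbb R^p)^*\times\mathbb Z^q\times\mathbb T^q$, $\mathbb T=\mathbb R/\mathbb Z$. An element $h\in D$ is written $h=(w_{h1},w_{h2},m,r)$ with $w_{h1},w_{h2}\in\mathbb R^p$, $m\in\mathbb Z^q$, and $r\in\mathbb R^q$ the real representative given by $\Phi$ (so the representatives are additive in $h$). Heisenberg representation. For $h\in D$ and $f$ on $\mathbb R^p\times\mathbb Z^q$, $$\pi_hf(s,n)=e^{2\pi i(w_{h2}\cdot s+r\cdot n)+\pi i(w_{h1}\cdot w_{h2}+m\cdot r)}f(s+w_{h1},n+m).$$ The cocycle $\alpha$ is defined by $\pi_g\pi_h=\alpha(g,h)\pi_{g+h}$. Algebra. $\mathcal S(D)$ is the algebra of series $\sum_{h\in D}a_he_{D,\alpha}(h)$ with rapidly decreasing coefficients, where $e_{D,\alpha}(h)$ is the delta function at $h$ and $e_{D,\alpha}(g)e_{D,\alpha}(h)=\alpha(g,h)e_{D,\alpha}(g+h)$. Inner product. For Schwartz functions $f,g$ on $\mathbb R^p\times\mathbb Z^q$, ${}_D\langle f,g\rangle=\sum_{h\in D}\langle f,\pi_hg\rangle e_{D,\alpha}(h)$, where $\langle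 f,g\rangle=\sum_{n\in\mathbb Z^q}\int_{\mathbb R^p}f(s,n)\overline{g(s,n)}\,ds$. Classical theta function: $\theta(\tau,z)=\sum_{n\in\mathbb Z}e^{\pi i\tau n^2+2\pi inz}$. *)

theory Defs
  imports
    "HOL-Analysis.Lebesgue_Measure"
    "HOL-Analysis.Bochner_Integration"
    "HOL-Analysis.Infinite_Sum"
    "HOL-Analysis.Product_Topology"
    "HOL-Analysis.Function_Topology"
    "HOL-Library.Set_Algebras"
    "HOL-Library.Product_Plus"
    "HOL-Algebra.Coset"
    "Jordan_Normal_Form.Determinant"
    "Jordan_Normal_Form.Gauss_Jordan_Elimination"
begin

section \<open>Lattices in topological groups\<close>

definition quotient_topology :: "'a topology \<Rightarrow> ('a \<Rightarrow> 'b) \<Rightarrow> 'b topology" where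
  "quotient_topology X f =
     topology (\<lambda>U. U \<subseteq> f ` topspace X \<and> openin X {x \<in> topspace X. f x \<in> U})"

lemma openin_quotient_topology:
  "openin (quotient_topology X f) U \<longleftrightarrow>
     U \<subseteq> f ` topspace X \<and> openin X {x \<in> topspace X. f x \<in> U}"
proof -
  let ?P = "\<lambda>U. U \<subseteq> f ` topspace X \<and> openin X {x \<in> topspace X. f x \<in> U}"
  have "istopology ?P"
    unfolding istopology_def
  proof (intro conjI allI impI)
    fix S T assume S: "?P S" and T: "?P T"
    show "S \<inter> T \<subseteq> f ` topspace X" using S by blast
    have "{x \<in> topspace X. f x \<in> S \<inter> T} =
            {x \<in> topspace X. f x \<in> S} \<inter> {x \<in> topspace X. f x \<in> T}" by blast
    then show "openin X {x \<in> topspace X. f x \<in> S \<inter> T}"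
      using S T by (simp add: openin_Int)
  next
    fix \<K> assume K: "\<forall>K\<in>\<K>. ?P K"
    show "\<Union>\<K> \<subseteq> f ` topspace X" using K by blast
    have "{x \<in> topspace X. f x \<in> \<Union>\<K>} = (\<Union>K\<in>\<K>. {x \<in> topspace X. f x \<in> K})" by blast
    then show "openin X {x \<in> topspace X. f x \<in> \<Union>\<K>}"
      using K by (auto intro!: openin_Union)
  qed
  then show ?thesis
    unfolding quotient_topology_def by (simp add: topology_inverse')
qed

lemma topspace_quotient_topology: "topspace (quotient_topology X f) = f ` topspace X"
proof
  show "topspace (quotient_topology X f) \<subseteq> f ` topspace X"
    using openin_topspace[of "quotient_topology X f"]
    unfolding openin_quotient_topology by (rule conjunct1)
  have "{x \<in> topspace X. f x \<in> f ` topspace X} = topspace X" by blast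
  then have "openin (quotient_topology X f) (f ` topspace X)"
    by (simp add: openin_quotient_topology)
  then show "f ` topspace X \<subseteq> topspace (quotient_topology X f)"
    by (rule openin_subset)
qed

lemma quotient_map_quotient_topology: "quotient_map X (quotient_topology X f) f"
  by (simp add: quotient_map_def topspace_quotient_topology openin_quotient_topology)

definition lattice_in :: "('a, 'b) monoid_scheme \<Rightarrow> 'a topology \<Rightarrow> 'a set \<Rightarrow> bool" where
  "lattice_in G X D \<longleftrightarrow>
     subgroup D G \<and>
     subtopology X D = discrete_topology D \<and>
     compact_space (quotient_topology X (\<lambda>g. D #>\<^bsub>G\<^esub> g))"

section \<open>The phase space\<close>

definition vec_topology :: "nat \<Rightarrow> 'a topology \<Rightarrow> 'a vec topology" where
  "vec_topology n X =
     pullback_topology (carrier_vec n) (\<lambda>v. \<lambda>i\<in>{..<n}. vec_index v i)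
       (product_topology (\<lambda>_. X) {..<n})"

text \<open>Points of \<open>\<real>/\<int>\<close> are cosets, added as sets.\<close>

definition mod1 :: "real \<Rightarrow> real set" where
  "mod1 r = {x. x - r \<in> \<int>}"

definition circle :: "real set topology" where
  "circle = quotient_topology euclideanreal mod1"

text \<open>A \<open>point\<close> \<open>(w1, w2, m, r)\<close> keeps a real representative \<open>r\<close> of its last component;
  a \<open>tpoint\<close> is the corresponding element of the phase space, with that component in
  \<open>(\<real>/\<int>)\<^sup>q\<close>.\<close>

type_synonym point = "real vec \<times> real vec \<times> int vec \<times> real vec"
type_synonym tpoint = "real vec \<times> real vec \<times> int vec \<times> real set vec"

definition reduce :: "point \<Rightarrow> tpoint" where
  "reduce = (\<lambda>(w1, w2, m, r). (w1, w2, m, map_vec mod1 r))"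

definition phase_topology :: "nat \<Rightarrow> nat \<Rightarrow> tpoint topology" where
  "phase_topology p q =
     prod_topology (vec_topology p euclideanreal)
       (prod_topology (vec_topology p euclideanreal)
         (prod_topology (vec_topology q (discrete_topology UNIV)) (vec_topology q circle)))"

definition phase_group :: "nat \<Rightarrow> nat \<Rightarrow> tpoint monoid" where
  "phase_group p q =
     \<lparr>carrier = topspace (phase_topology p q), mult = (+),
      one = (0\<^sub>v p, 0\<^sub>v p, 0\<^sub>v q, vec q (\<lambda>_. \<int>))\<rparr>"

lemma mod1_plus: "mod1 x + mod1 y = mod1 (x + y)"
proof
  show "mod1 x + mod1 y \<subseteq> mod1 (x + y)"
  proof
    fix z assume "z \<in> mod1 x + mod1 y"
    then obtain a b where "z = a + b" "a - x \<in> \<int>" "b - y \<in> \<int>"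
      by (auto simp: mod1_def set_plus_def)
    then have "(a - x) + (b - y) \<in> \<int>" by (intro Ints_add)
    moreover have "z - (x + y) = (a - x) + (b - y)" using \<open>z = a + b\<close> by simp
    ultimately show "z \<in> mod1 (x + y)" by (simp only: mod1_def mem_Collect_eq)
  qed
  show "mod1 (x + y) \<subseteq> mod1 x + mod1 y"
  proof
    fix z assume "z \<in> mod1 (x + y)"
    then have "z - y \<in> mod1 x" "y \<in> mod1 y"
      by (auto simp: mod1_def algebra_simps)
    moreover have "z = (z - y) + y" by simp
    ultimately show "z \<in> mod1 x + mod1 y" unfolding set_plus_def by blast
  qed
qed

lemma mod1_0: "mod1 0 = \<int>"
  by (simp add: mod1_def)

lemma topspace_circle: "topspace circle = range mod1"
  by (simp add: circle_def topspace_quotient_topology)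

lemma topspace_vec_topology:
  "topspace (vec_topology n X) = {v \<in> carrier_vec n. \<forall>i<n. vec_index v i \<in> topspace X}"
proof -
  have "topspace (vec_topology n X) =
    (\<lambda>v. \<lambda>i\<in>{..<n}. vec_index v i) -` (\<Pi>\<^sub>E i\<in>{..<n}. topspace X) \<inter> carrier_vec n"
    by (simp only: vec_topology_def topspace_pullback_topology topspace_product_topology o_def)
  also have "\<dots> = {v \<in> carrier_vec n. \<forall>i<n. vec_index v i \<in> topspace X}"
    unfolding PiE_def Pi_def by auto
  finally show ?thesis .
qed

lemma carrier_phase_group:
  "carrier (phase_group p q) =
     carrier_vec p \<times> carrier_vec p \<times> carrier_vec q \<times> {t \<in> carrier_vec q. \<forall>i<q. vec_index t i \<in> range mod1}"
  by (auto simp: phase_group_def phase_topology_def topspace_vec_topology topspace_circle)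

lemma carrier_phase_group_eq_reduce:
  "carrier (phase_group p q) =
     reduce ` (carrier_vec p \<times> carrier_vec p \<times> carrier_vec q \<times> carrier_vec q)"
proof -
  have t: "{t \<in> carrier_vec q. \<forall>i<q. vec_index t i \<in> range mod1} = map_vec mod1 ` carrier_vec q"
  proof (rule equalityI; rule subsetI)
    fix t assume "t \<in> {t \<in> carrier_vec q. \<forall>i<q. vec_index t i \<in> range mod1}"
    then have t: "t \<in> carrier_vec q" "\<forall>i<q. \<exists>x. vec_index t i = mod1 x"
      by (simp, blast)
    then obtain g where g: "\<forall>i<q. vec_index t i = mod1 (g i)"
      by metis
    have "t = map_vec mod1 (vec q g)"
      by (rule eq_vecI) (use t(1) g in simp_all)
    then show "t \<in> map_vec mod1 ` carrier_vec q"
      by (rule image_eqI) simp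
  next
    fix t assume "t \<in> map_vec mod1 ` carrier_vec q"
    then obtain r where "r \<in> carrier_vec q" "t = map_vec mod1 r" by (rule imageE)
    then show "t \<in> {t \<in> carrier_vec q. \<forall>i<q. vec_index t i \<in> range mod1}" by simp
  qed
  show ?thesis
    unfolding carrier_phase_group t reduce_def
    by (simp add: image_iff set_eq_iff)
qed

lemma reduce_add:
  assumes "g \<in> carrier_vec p \<times> carrier_vec p \<times> carrier_vec q \<times> carrier_vec q"
    and "h \<in> carrier_vec p \<times> carrier_vec p \<times> carrier_vec q \<times> carrier_vec q"
  shows "reduce g + reduce h = reduce (g + h)"
proof -
  have "map_vec mod1 r + map_vec mod1 r' = map_vec mod1 (r + r')"
    if "r \<in> carrier_vec q" "r' \<in> carrier_vec q" for r r'
    by (rule eq_vecI) (use that in \<open>simp_all add: mod1_plus\<close>)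
  then show ?thesis using assms by (cases g, cases h) (simp add: reduce_def)
qed

lemma group_phase_group: "group (phase_group p q)"
proof -
  let ?V = "carrier_vec p \<times> carrier_vec p \<times> carrier_vec q \<times> carrier_vec q :: point set"
  have closed: "g + h \<in> ?V" if "g \<in> ?V" "h \<in> ?V" for g h
    using that by (cases g, cases h) simp
  have mult: "mult (phase_group p q) = (+)"
    by (simp add: phase_group_def)
  have zero: "map_vec mod1 (0\<^sub>v q) = vec q (\<lambda>_. \<int>)"
    by (rule eq_vecI) (simp_all add: mod1_0)
  have one: "one (phase_group p q) = reduce (0\<^sub>v p, 0\<^sub>v p, 0\<^sub>v q, 0\<^sub>v q)"
    by (simp add: phase_group_def reduce_def zero)
  show ?thesis
  proof (rule groupI, unfold carrier_phase_group_eq_reduce mult one)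
    fix x y assume "x \<in> reduce ` ?V" "y \<in> reduce ` ?V"
    then obtain a b where ab: "a \<in> ?V" "b \<in> ?V" "x = reduce a" "y = reduce b"
      by (elim imageE)
    show "x + y \<in> reduce ` ?V"
      unfolding ab(3,4) reduce_add[OF ab(1,2)] by (rule imageI) (rule closed[OF ab(1,2)])
  next
    show "reduce (0\<^sub>v p, 0\<^sub>v p, 0\<^sub>v q, 0\<^sub>v q) \<in> reduce ` ?V" by auto
  next
    fix x y z assume "x \<in> reduce ` ?V" "y \<in> reduce ` ?V" "z \<in> reduce ` ?V"
    then obtain a b c where abc: "a \<in> ?V" "b \<in> ?V" "c \<in> ?V"
      and eq: "x = reduce a" "y = reduce b" "z = reduce c" by (elim imageE)
    have "a + b + c = a + (b + c)"
      using abc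
      by (cases a, cases b, cases c) (simp add: assoc_add_vec[of _ p] assoc_add_vec[of _ q])
    then show "x + y + z = x + (y + z)"
      unfolding eq reduce_add[OF abc(1,2)] reduce_add[OF abc(2,3)]
        reduce_add[OF closed[OF abc(1,2)] abc(3)] reduce_add[OF abc(1) closed[OF abc(2,3)]]
      by simp
  next
    fix x assume "x \<in> reduce ` ?V"
    then obtain a where a: "a \<in> ?V" "x = reduce a" by (elim imageE)
    have z: "(0\<^sub>v p, 0\<^sub>v p, 0\<^sub>v q, 0\<^sub>v q) \<in> ?V" by simp
    have "(0\<^sub>v p, 0\<^sub>v p, 0\<^sub>v q, 0\<^sub>v q) + a = a" using a(1) by (cases a) simp
    then show "reduce (0\<^sub>v p, 0\<^sub>v p, 0\<^sub>v q, 0\<^sub>v q) + x = x"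
      unfolding a(2) reduce_add[OF z a(1)] by simp
    obtain w1 w2 m r where w: "a = (w1, w2, m, r)" by (cases a)
    have n: "(- w1, - w2, - m, - r) \<in> ?V" using a(1) w by simp
    have s: "(- w1, - w2, - m, - r) + a = (0\<^sub>v p, 0\<^sub>v p, 0\<^sub>v q, 0\<^sub>v q)"
      using a(1) w by simp
    show "\<exists>y\<in>reduce ` ?V. y + x = reduce (0\<^sub>v p, 0\<^sub>v p, 0\<^sub>v q, 0\<^sub>v q)"
      using imageI[OF n, of reduce] reduce_add[OF n a(1)] unfolding s a(2) by (rule bexI[rotated])
  qed
qed

section \<open>The embedding\<close>

text \<open>\<open>floor\<close> only changes the type here, as the rows concerned have integer entries.\<close>

definition embed :: "nat \<Rightarrow> nat \<Rightarrow> real mat \<Rightarrow> int vec \<Rightarrow> point" where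
  "embed p q \<Phi> x =
     (let v = \<Phi> *\<^sub>v map_vec real_of_int x in
       (vec p (\<lambda>i. vec_index v i),
        vec p (\<lambda>i. vec_index v (p + i)),
        vec q (\<lambda>i. \<lfloor>vec_index v (2 * p + i)\<rfloor>),
        vec q (\<lambda>i. vec_index v (2 * p + q + i))))"

text \<open>As \<open>reduce\<close> is injective on it, the image of the embedding stands for the lattice,
  each element being given with its real representative.\<close>

definition lattice_pts :: "nat \<Rightarrow> nat \<Rightarrow> real mat \<Rightarrow> point set" where
  "lattice_pts p q \<Phi> = embed p q \<Phi> ` carrier_vec (2 * p + q)"

definition lattice_embedding :: "nat \<Rightarrow> nat \<Rightarrow> real mat \<Rightarrow> bool" where
  "lattice_embedding p q \<Phi> \<longleftrightarrow>
     \<Phi> \<in> carrier_mat (2 * p + 2 * q) (2 * p + q) \<and>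
     (\<forall>i\<in>{2 * p..<2 * p + q}. \<forall>j<2 * p + q. \<Phi> $$ (i, j) \<in> \<int>) \<and>
     inj_on (\<lambda>x. reduce (embed p q \<Phi> x)) (carrier_vec (2 * p + q)) \<and>
     lattice_in (phase_group p q) (phase_topology p q) (reduce ` lattice_pts p q \<Phi>)"

section \<open>The Heisenberg representation\<close>

definition heisenberg ::
    "point \<Rightarrow> (real vec \<Rightarrow> int vec \<Rightarrow> complex) \<Rightarrow> real vec \<Rightarrow> int vec \<Rightarrow> complex" where
  "heisenberg = (\<lambda>(w1, w2, m, r) f s n.
     exp (2 * pi * \<i> * complex_of_real (scalar_prod w2 s + scalar_prod r (map_vec real_of_int n))
        + pi * \<i> * complex_of_real (scalar_prod w1 w2 + scalar_prod (map_vec real_of_int m) r))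
     * f (s + w1) (n + m))"

definition cocycle :: "nat \<Rightarrow> nat \<Rightarrow> point \<Rightarrow> point \<Rightarrow> complex" where
  "cocycle p q g h =
     (THE c. \<forall>f. \<forall>s\<in>carrier_vec p. \<forall>n\<in>carrier_vec q.
        heisenberg g (heisenberg h f) s n = c * heisenberg (g + h) f s n)"

lemma heisenberg_heisenberg:
  assumes "w1 \<in> carrier_vec p" "w2 \<in> carrier_vec p" "m \<in> carrier_vec q" "r \<in> carrier_vec q"
    and "w1' \<in> carrier_vec p" "w2' \<in> carrier_vec p" "m' \<in> carrier_vec q" "r' \<in> carrier_vec q"
    and "s \<in> carrier_vec p" "n \<in> carrier_vec q"
  shows "heisenberg (w1, w2, m, r) (heisenberg (w1', w2', m', r') f) s n =
    exp (pi * \<i> * complex_of_real (scalar_prod w2' w1 - scalar_prod w1' w2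
        + scalar_prod (map_vec real_of_int m) r' - scalar_prod (map_vec real_of_int m') r))
    * heisenberg ((w1, w2, m, r) + (w1', w2', m', r')) f s n"
proof -
  have mv: "map_vec real_of_int (a + b) = map_vec real_of_int a + map_vec real_of_int b"
    if "a \<in> carrier_vec q" "b \<in> carrier_vec q" for a b
    using that by (intro eq_vecI) auto
  have c: "map_vec real_of_int a \<in> carrier_vec q" if "a \<in> carrier_vec q" for a
    using that by simp
  have sw: "s + w1 + w1' = s + (w1 + w1')" "n + m + m' = n + (m + m')"
    using assms by (auto intro!: assoc_add_vec)
  have comm: "scalar_prod w2 w1' = scalar_prod w1' w2" "scalar_prod w2' w1 = scalar_prod w1 w2'"
     "scalar_prod r' (map_vec real_of_int m) = scalar_prod (map_vec real_of_int m) r'"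
    using assms by (auto intro!: comm_scalar_prod)
  have dist: "scalar_prod w2' (s + w1) = scalar_prod w2' s + scalar_prod w2' w1"
    "scalar_prod r' (map_vec real_of_int n + map_vec real_of_int m) =
       scalar_prod r' (map_vec real_of_int n) + scalar_prod r' (map_vec real_of_int m)"
    "scalar_prod (w2 + w2') s = scalar_prod w2 s + scalar_prod w2' s"
    "scalar_prod (r + r') (map_vec real_of_int n) =
       scalar_prod r (map_vec real_of_int n) + scalar_prod r' (map_vec real_of_int n)"
    "scalar_prod (w1 + w1') (w2 + w2') = scalar_prod w1 w2 + scalar_prod w1 w2'
       + (scalar_prod w1' w2 + scalar_prod w1' w2')"
    "scalar_prod (map_vec real_of_int m + map_vec real_of_int m') (r + r') =
       scalar_prod (map_vec real_of_int m) r + scalar_prod (map_vec real_of_int m) r'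
       + (scalar_prod (map_vec real_of_int m') r + scalar_prod (map_vec real_of_int m') r')"
    using assms
    by (simp_all add: scalar_prod_add_distrib[of _ p] scalar_prod_add_distrib[of _ q]
        add_scalar_prod_distrib[of _ p] add_scalar_prod_distrib[of _ q] c)
  have phase: "exp a * (exp b * z) = exp c * (exp d * z)" if "a + b = c + d" for a b c d z :: complex
    by (metis that exp_add mult.assoc)
  have add: "(w1, w2, m, r) + (w1', w2', m', r') = (w1 + w1', w2 + w2', m + m', r + r')"
    by simp
  show ?thesis
    unfolding add heisenberg_def prod.case sw mv[OF assms(3,7)] mv[OF assms(10,3)] dist comm
    by (rule phase) (simp add: algebra_simps)
qed

lemma cocycle_eq:
  assumes "w1 \<in> carrier_vec p" "w2 \<in> carrier_vec p" "m \<in> carrier_vec q" "r \<in> carrier_vec q"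
    and "w1' \<in> carrier_vec p" "w2' \<in> carrier_vec p" "m' \<in> carrier_vec q" "r' \<in> carrier_vec q"
  shows "cocycle p q (w1, w2, m, r) (w1', w2', m', r') =
    exp (pi * \<i> * complex_of_real (scalar_prod w2' w1 - scalar_prod w1' w2
        + scalar_prod (map_vec real_of_int m) r' - scalar_prod (map_vec real_of_int m') r))"
  unfolding cocycle_def
proof (rule the_equality)
  fix c
  assume *: "\<forall>f. \<forall>s\<in>carrier_vec p. \<forall>n\<in>carrier_vec q.
    heisenberg (w1, w2, m, r) (heisenberg (w1', w2', m', r') f) s n =
    c * heisenberg ((w1, w2, m, r) + (w1', w2', m', r')) f s n"
  have "heisenberg ((w1, w2, m, r) + (w1', w2', m', r')) (\<lambda>_ _. 1) (0\<^sub>v p) (0\<^sub>v q) \<noteq> 0"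
    by (simp add: heisenberg_def)
  moreover note *[rule_format, of "0\<^sub>v p" "0\<^sub>v q" "\<lambda>_ _. 1", unfolded
      heisenberg_heisenberg[OF assms zero_carrier_vec zero_carrier_vec]]
  ultimately show "c = exp (pi * \<i> * complex_of_real (scalar_prod w2' w1 - scalar_prod w1' w2
        + scalar_prod (map_vec real_of_int m) r' - scalar_prod (map_vec real_of_int m') r))"
    by simp
qed (use heisenberg_heisenberg[OF assms] in simp)

section \<open>The twisted algebra\<close>

text \<open>A formal series over the lattice \<open>D\<close> is its coefficient function, taken to vanish off
  \<open>D\<close>.\<close>

definition delta :: "point \<Rightarrow> point \<Rightarrow> complex" where
  "delta h = (\<lambda>k. if k = h then 1 else 0)"

definition series :: "point set \<Rightarrow> (point \<Rightarrow> complex) \<Rightarrow> point \<Rightarrow> complex" where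
  "series D a = (\<lambda>k. \<Sum>\<^sub>\<infinity>h\<in>D. a h * delta h k)"

lemma series_apply: "series D a k = (if k \<in> D then a k else 0)"
proof -
  have "series D a k = (\<Sum>\<^sub>\<infinity>h\<in>D \<inter> {k}. a h * delta h k)"
    unfolding series_def by (rule infsum_cong_neutral) (auto simp: delta_def)
  then show ?thesis by (simp add: delta_def)
qed

definition twisted_mult ::
    "nat \<Rightarrow> nat \<Rightarrow> point set \<Rightarrow> (point \<Rightarrow> complex) \<Rightarrow> (point \<Rightarrow> complex) \<Rightarrow> point \<Rightarrow> complex" where
  "twisted_mult p q D a b =
     (\<lambda>k. \<Sum>\<^sub>\<infinity>(g, h)\<in>D \<times> D. a g * b h * cocycle p q g h * delta (g + h) k)"

lemma twisted_mult_delta: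
  assumes "g \<in> D" "h \<in> D"
  shows "twisted_mult p q D (delta g) (delta h) = (\<lambda>k. cocycle p q g h * delta (g + h) k)"
proof
  fix k
  have "twisted_mult p q D (delta g) (delta h) k =
    (\<Sum>\<^sub>\<infinity>(g', h')\<in>{(g, h)}. delta g g' * delta h h' * cocycle p q g' h' * delta (g' + h') k)"
    unfolding twisted_mult_def
    by (rule infsum_cong_neutral) (use assms in \<open>auto simp: delta_def split: if_splits\<close>)
  then show "twisted_mult p q D (delta g) (delta h) k = cocycle p q g h * delta (g + h) k"
    by (simp add: delta_def)
qed

definition rapidly_decreasing :: "nat \<Rightarrow> nat \<Rightarrow> real mat \<Rightarrow> (point \<Rightarrow> complex) \<Rightarrow> bool" where
  "rapidly_decreasing p q \<Phi> a \<longleftrightarrow>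
     (\<forall>N::nat. \<exists>C. \<forall>x\<in>carrier_vec (2 * p + q).
        (1 + (\<Sum>i<2 * p + q. \<bar>real_of_int (vec_index x i)\<bar>)) ^ N * cmod (a (embed p q \<Phi> x)) \<le> C)"

definition schwartz_algebra :: "nat \<Rightarrow> nat \<Rightarrow> real mat \<Rightarrow> (point \<Rightarrow> complex) ring" where
  "schwartz_algebra p q \<Phi> =
     \<lparr>carrier = {a. (\<forall>k. k \<notin> lattice_pts p q \<Phi> \<longrightarrow> a k = 0) \<and> rapidly_decreasing p q \<Phi> a},
      mult = twisted_mult p q (lattice_pts p q \<Phi>),
      one = delta (0\<^sub>v p, 0\<^sub>v p, 0\<^sub>v q, 0\<^sub>v q),
      zero = (\<lambda>_. 0),
      add = (\<lambda>a b k. a k + b k)\<rparr>"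

section \<open>The algebra-valued inner product\<close>

definition L2_inner ::
    "nat \<Rightarrow> nat \<Rightarrow> (real vec \<Rightarrow> int vec \<Rightarrow> complex) \<Rightarrow> (real vec \<Rightarrow> int vec \<Rightarrow> complex) \<Rightarrow> complex" where
  "L2_inner p q f g =
     (\<Sum>\<^sub>\<infinity>n\<in>carrier_vec q.
        integral\<^sup>L (Pi\<^sub>M {..<p} (\<lambda>_. lborel)) (\<lambda>s. f (vec p s) n * cnj (g (vec p s) n)))"

definition D_inner ::
    "nat \<Rightarrow> nat \<Rightarrow> real mat \<Rightarrow> (real vec \<Rightarrow> int vec \<Rightarrow> complex) \<Rightarrow> (real vec \<Rightarrow> int vec \<Rightarrow> complex)
      \<Rightarrow> point \<Rightarrow> complex" where
  "D_inner p q \<Phi> f g = series (lattice_pts p q \<Phi>) (\<lambda>h. L2_inner p q f (heisenberg h g))"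

section \<open>Theta functions\<close>

definition pos_def_mat :: "nat \<Rightarrow> real mat \<Rightarrow> bool" where
  "pos_def_mat p A \<longleftrightarrow> (\<forall>x\<in>carrier_vec p. x \<noteq> 0\<^sub>v p \<longrightarrow> 0 < scalar_prod x (A *\<^sub>v x))"

definition theta :: "complex \<Rightarrow> complex \<Rightarrow> complex" where
  "theta \<tau> z = (\<Sum>\<^sub>\<infinity>n\<in>(UNIV :: int set). exp (pi * \<i> * \<tau> * of_int n ^ 2 + 2 * pi * \<i> * of_int n * z))"

definition gauss_fun :: "nat \<Rightarrow> nat \<Rightarrow> complex mat \<Rightarrow> real vec \<Rightarrow> int vec \<Rightarrow> complex" where
  "gauss_fun p q \<Omega> s n =
     exp (pi * \<i> * (\<Sum>j<p. \<Sum>k<p. of_real (vec_index s j) * \<Omega> $$ (j, k) * of_real (vec_index s k))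
        - pi / 2 * (\<Sum>i<q div 2. of_int (vec_index n i) ^ 2 + of_int (vec_index n (q div 2 + i)) ^ 2))"

definition underline_w :: "complex mat \<Rightarrow> point \<Rightarrow> complex vec" where
  "underline_w \<Omega> = (\<lambda>(w1, w2, m, r).
     \<Omega> *\<^sub>v map_vec complex_of_real w1 + map_vec complex_of_real w2)"

definition herm_form :: "complex mat \<Rightarrow> complex vec \<Rightarrow> complex vec \<Rightarrow> complex" where
  "herm_form \<Omega> v w =
     scalar_prod v (map_mat complex_of_real (the (mat_inverse (map_mat Im \<Omega>))) *\<^sub>v map_vec cnj w)"

definition b_coeff :: "real \<Rightarrow> int \<Rightarrow> complex" where
  "b_coeff r m = exp (- pi / 2 * of_int m ^ 2 - pi * \<i> * of_int m * of_real r)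
     * theta \<i> (- of_real r + \<i> * of_int m / 2)"

definition b_tilde :: "nat \<Rightarrow> point \<Rightarrow> complex" where
  "b_tilde q = (\<lambda>(w1, w2, m, r). \<Prod>j<q. b_coeff (vec_index r j) (vec_index m j))"

end

(* The integrand defining <f, pi_h f> splits into a Gaussian in s with complex linear term and a
   product of one-dimensional lattice Gaussians in n; summing the latter gives the factors b. The
   former is integrated by eliminating one variable at a time (Schur complements), and with
   V = (Im Omega)^(-1) conj(w_h) its value collapses to exp(-pi/2 H(w_h, w_h)).

   For rapid decay one needs that x |-> (w_1, w_2, m) is injective on R^d, not just on Z^d: a real
   kernel vector would yield, by a pigeonhole argument, nonzero lattice points arbitrarily close to
   the origin. Hence H(w_h, w_h) + |m|^2 is a positive definite quadratic form in x and the
   coefficients decay like exp(-c |x|^2). *)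

theory Submission
  imports Defs "HOL-Probability.Characteristic_Functions"
begin

section \<open>Gaussian integrals\<close>

text \<open>Membership of the series in the Schwartz algebra is part of the claim. The modulus of
  each theta factor is 1-periodic in r, so r yields no decay: all of it must come from (w_1, w_2,
  m), that is from d of the d + q rows of Phi. Injectivity on integer vectors alone would not keep
  these d linear forms from having a common real zero. The pigeonhole argument can ignore the
  remaining q rows because they take values in a compact torus.

  The quadratic part of the Gaussian is 2 Im Omega, since f contributes Omega and the conjugated
  factor contributes conj(Omega) with the opposite sign; this is the origin of 2^p det(Im Omega).
  The linear coefficient is conj(w_h), because the shift by w_1 happens inside the conjugated
  factor. The collapse to H rests on w_h - conj(w_h) = 2 i (Im Omega) w_1: paired with V, it
  accounts for exactly the constant that the shift leaves in the exponent.\<close>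

lemma gaussian_std_has_integral:
  fixes t :: real
  shows "has_bochner_integral lborel (\<lambda>x. exp (- complex_of_real (x^2/2) + \<i> * of_real (t * x)))
    (of_real (sqrt (2 * pi) * exp (- (t^2/2))))"
proof -
  \<comment> \<open>The value comes from the characteristic function of the standard normal law;
    integrability holds because the integrand has modulus 1 under a probability measure.\<close>
  have "integrable std_normal_distribution (\<lambda>x. iexp (t * x))"
    by (rule finite_measure.integrable_const_bound[where B=1])
      (auto simp: prob_space.finite_measure prob_space_normal_density)
  moreover have "(LINT x|std_normal_distribution. iexp (t * x)) = of_real (exp (- (t^2/2)))"
    using fun_cong[OF char_std_normal_distribution, of t] by (simp add: char_def)
  ultimately have "has_bochner_integral lborel (\<lambda>x. std_normal_density x *\<^sub>R iexp (t * x)) (of_real (exp (- (t^2/2))))"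
    by (simp add: has_bochner_integral_iff integrable_density integral_density)
  then have "has_bochner_integral lborel (\<lambda>x. of_real (sqrt (2 * pi)) * (std_normal_density x *\<^sub>R iexp (t * x)))
     (of_real (sqrt (2 * pi)) * (of_real (exp (- (t^2/2)))))"
    by (rule has_bochner_integral_mult_right)
  moreover have "of_real (sqrt (2 * pi)) * (std_normal_density x *\<^sub>R iexp (t * x)) =
    exp (- complex_of_real (x^2/2) + \<i> * of_real (t * x))" for x
    unfolding normal_density_def exp_add scaleR_conv_of_real
    by (simp flip: exp_of_real add: field_simps)
  ultimately show ?thesis by simp
qed

text \<open>A full completion of the square would need a complex translation and a change of
  contour. Instead a real translation removes only the part of the linear term due to
  \<open>Im c\<close>; the part due to \<open>Re c\<close> is oscillating and becomes the frequency
  of a Fourier transform.\<close>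

lemma gaussian_integral_complex:
  fixes a :: real and c :: complex
  assumes a: "a > 0"
  shows "has_bochner_integral lborel
    (\<lambda>x. exp (- of_real (pi * a * x^2) - 2 * of_real pi * \<i> * of_real x * c))
    (exp (- of_real pi * c^2 / of_real a) / of_real (sqrt a))"
proof -
  define \<alpha> \<beta> where "\<alpha> = Re c" and "\<beta> = Im c"
  have c: "c = of_real \<alpha> + \<i> * of_real \<beta>" by (simp add: \<alpha>_def \<beta>_def complex_eq)
  \<comment> \<open>With y = k (x - \<beta> / a) one has y^2 / 2 = pi a (x - \<beta> / a)^2,
    \<open>t\<close> is the frequency belonging to y, and \<open>K\<close> collects the constants
    that the translation releases.\<close>
  define k where "k = sqrt (2 * pi * a)"
  have k: "k > 0" "k^2 = 2 * pi * a" using a by (auto simp: k_def)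
  define t where "t = - 2 * pi * \<alpha> / k"
  define K where "K = exp (of_real pi * of_real (\<beta>^2 / a) - 2 * of_real pi * \<i> * of_real (\<alpha> * \<beta> / a))"
  let ?f = "\<lambda>x. exp (- complex_of_real (x^2/2) + \<i> * of_real (t * x))"
  have *: "has_bochner_integral lborel (\<lambda>x. ?f (- k * \<beta> / a + k * x))
     ((of_real (sqrt (2 * pi) * exp (- (t^2/2)))) /\<^sub>R \<bar>k\<bar>)"
    using gaussian_std_has_integral[of t] k lborel_has_bochner_integral_real_affine_iff[of k ?f _ "- k * \<beta> / a"]
    by auto
  have "has_bochner_integral lborel (\<lambda>x. K * ?f (- k * \<beta> / a + k * x))
     (K * ((of_real (sqrt (2 * pi) * exp (- (t^2/2)))) /\<^sub>R \<bar>k\<bar>))"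
    by (rule has_bochner_integral_mult_right) (use * in auto)
  moreover have "K * ?f (- k * \<beta> / a + k * x) = exp (- of_real (pi * a * x^2) - 2 * of_real pi * \<i> * of_real x * c)" for x
  proof -
    have "(- k * \<beta> / a + k * x)^2 = k^2 * (x - \<beta> / a)^2"
      by (simp add: power2_eq_square algebra_simps)
    then have 1: "(- k * \<beta> / a + k * x)^2 / 2 = pi * a * (x - \<beta>/a)^2" by (simp add: k)
    have 2: "t * (- k * \<beta> / a + k * x) = - 2 * pi * \<alpha> * (x - \<beta>/a)"
      using k a by (simp add: t_def field_simps)
    show ?thesis unfolding 1 2 K_def c exp_add[symmetric]
      by (rule arg_cong[where f=exp]) (use a in \<open>simp add: complex_eq_iff power2_eq_square field_simps\<close>)
  qed
  moreover have "K * ((of_real (sqrt (2 * pi) * exp (- (t^2/2)))) /\<^sub>R \<bar>k\<bar>) = exp (- of_real pi * c^2 / of_real a) / of_real (sqrt a)"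
  proof -
    have 1: "sqrt (2 * pi) / k = 1 / sqrt a" using a by (simp add: k_def real_sqrt_mult)
    have 2: "t^2/2 = pi * \<alpha>^2 / a" using k a by (simp add: t_def power_divide field_simps power2_eq_square)
    have "K * ((of_real (sqrt (2 * pi) * exp (- (t^2/2)))) /\<^sub>R \<bar>k\<bar>) = K * exp (- of_real (t^2/2)) * of_real (sqrt (2*pi) / k)"
      using k by (simp add: scaleR_conv_of_real divide_simps flip: exp_of_real)
    also have "K * exp (- of_real (t^2/2)) = exp (- of_real pi * c^2 / of_real a)"
      unfolding 2 K_def c exp_add[symmetric]
      by (rule arg_cong[where f=exp]) (use a in \<open>simp add: complex_eq_iff power2_eq_square field_simps\<close>)
    finally show ?thesis unfolding 1 by (simp add: divide_simps)
  qed
  ultimately show ?thesis by simp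
qed

section \<open>Positive definite forms and Schur complements\<close>

text \<open>Homogeneity reduces the bound to the unit sphere, where a continuous positive function
  has a positive minimum. Vectors are functions on all of \<open>nat\<close>, so the sphere is cut
  out of a box whose coordinates from \<open>d\<close> on are 0, compact as a product of compact
  sets; by \<open>loc\<close> those coordinates do not affect \<open>F\<close>.\<close>

lemma quadratic_coercive:
  fixes F :: "(nat \<Rightarrow> real) \<Rightarrow> real"
  assumes cont: "continuous_on UNIV F"
    and hom: "\<And>t x. F (\<lambda>i. t * x i) = t^2 * F x"
    and pos: "\<And>x. \<exists>i<d. x i \<noteq> 0 \<Longrightarrow> F x > 0"
    and loc: "\<And>x y. (\<And>i. i < d \<Longrightarrow> x i = y i) \<Longrightarrow> F x = F y"
  shows "\<exists>c>0. \<forall>x. c * (\<Sum>i<d. (x i)^2) \<le> F x"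
proof -
  define B :: "(nat \<Rightarrow> real) set" where "B = PiE UNIV (\<lambda>i. if i < d then {-1..1} else {0})"
  define K where "K = B \<inter> {x. (\<Sum>i<d. (x i)^2) = 1}"
  have "compact B"
    unfolding B_def compactin_euclidean_iff[symmetric] euclidean_product_topology[symmetric]
      compactin_PiE by auto
  moreover have "closed {x::nat \<Rightarrow> real. (\<Sum>i<d. (x i)^2) = 1}"
    by (intro closed_Collect_eq continuous_intros) auto
  ultimately have K: "compact K" unfolding K_def by blast
  have F0: "F x = 0" if "\<And>i. i < d \<Longrightarrow> x i = 0" for x
    using loc[of x "\<lambda>i. 0 * x i"] that hom[of 0 x] by simp
  obtain c where c: "c > 0" "\<And>x. x \<in> K \<Longrightarrow> c \<le> F x"
  proof (cases "K = {}")
    case False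
    obtain x where x: "x \<in> K" "\<And>y. y \<in> K \<Longrightarrow> F x \<le> F y"
      using continuous_attains_inf[OF K False continuous_on_subset[OF cont]] by auto
    have "\<exists>i<d. x i \<noteq> 0"
    proof (rule ccontr)
      assume "\<not> ?thesis"
      then have "(\<Sum>i<d. (x i)^2) = 0" by simp
      with x(1) show False by (simp add: K_def)
    qed
    with x pos that[of "F x"] show ?thesis by blast
  \<comment> \<open>The sphere is empty exactly for \<open>d = 0\<close>, and then any constant
    serves.\<close>
  qed (use that[of 1] in auto)
  have "c * (\<Sum>i<d. (x i)^2) \<le> F x" for x
  proof (cases "\<exists>i<d. x i \<noteq> 0")
    case False
    then show ?thesis using F0[of x] by simp
  next
    case True
    define S where "S = (\<Sum>i<d. (x i)^2)"
    have S: "S > 0" unfolding S_def using True by (auto intro!: sum_pos2)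
    define y where "y = (\<lambda>i. if i < d then x i / sqrt S else 0)"
    have "(\<Sum>i<d. (y i)^2) = 1"
      using S by (simp add: y_def power_divide S_def flip: sum_divide_distrib)
    moreover have "y i \<in> {-1..1}" if "i < d" for i
    proof -
      have "(y i)^2 \<le> (\<Sum>i<d. (y i)^2)"
        using that by (intro member_le_sum) auto
      then have "\<bar>y i\<bar> \<le> 1" using \<open>_ = 1\<close> by (simp add: abs_square_le_1)
      then show ?thesis by auto
    qed
    ultimately have "y \<in> K" by (auto simp: K_def B_def y_def)
    then have "c \<le> F y" by (rule c)
    also have "F y = F (\<lambda>i. (1 / sqrt S) * x i)" by (rule loc) (simp add: y_def)
    also have "\<dots> = F x / S" unfolding hom using S by (simp add: power_divide)
    finally show ?thesis using S by (simp add: field_simps S_def)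
  qed
  with c show ?thesis by blast
qed

text \<open>Bilinear, without conjugation, over the complex numbers too. Matrices are functions on
  index pairs, so that passing to a smaller \<open>p\<close> in an induction needs no
  submatrices.\<close>

definition quad :: "nat \<Rightarrow> (nat \<Rightarrow> nat \<Rightarrow> 'a) \<Rightarrow> (nat \<Rightarrow> 'a) \<Rightarrow> 'a::comm_ring_1" where
  "quad p A s = (\<Sum>i<p. \<Sum>j<p. s i * A i j * s j)"

definition posdef :: "nat \<Rightarrow> (nat \<Rightarrow> nat \<Rightarrow> real) \<Rightarrow> bool" where
  "posdef p A \<longleftrightarrow> (\<forall>i<p. \<forall>j<p. A i j = A j i) \<and> (\<forall>s. (\<exists>i<p. s i \<noteq> 0) \<longrightarrow> quad p A s > 0)"

text \<open>The pivot is the last index \<open>p\<close> of a matrix of size \<open>Suc p\<close>,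
  the coordinate that is split off when an integral over \<open>{..<Suc p}\<close> is reduced to one
  over \<open>{..<p}\<close>.\<close>

definition schur :: "nat \<Rightarrow> (nat \<Rightarrow> nat \<Rightarrow> 'a) \<Rightarrow> nat \<Rightarrow> nat \<Rightarrow> 'a::field" where
  "schur p A i j = A i j - A i p * A p j / A p p"

lemma quad_cong: "(\<And>i. i < p \<Longrightarrow> s i = s' i) \<Longrightarrow> quad p A s = quad p A s'"
  unfolding quad_def by (intro sum.cong) auto

lemma quad_scale: "quad p A (\<lambda>i. t * s i) = t\<^sup>2 * quad p A s"
  unfolding quad_def sum_distrib_left by (simp add: power2_eq_square algebra_simps)

lemma posdef_coercive:
  assumes "posdef p A"
  shows "\<exists>c>0. \<forall>s. c * (\<Sum>i<p. (s i)^2) \<le> quad p A s"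
proof (rule quadratic_coercive)
  show "continuous_on UNIV (quad p A)"
    unfolding quad_def by (intro continuous_intros) auto
  show "quad p A (\<lambda>i. t * x i) = t\<^sup>2 * quad p A x" for t x
    by (rule quad_scale)
  show "0 < quad p A x" if "\<exists>i<p. x i \<noteq> 0" for x
    using assms that by (auto simp: posdef_def)
qed (rule quad_cong)

text \<open>Completing the square in the last variable. A general field is allowed because this is
  applied both to the real form under the integral and to the complex form in its value.\<close>

lemma quad_schur:
  fixes A :: "nat \<Rightarrow> nat \<Rightarrow> 'a::field"
  assumes sym: "\<And>i. i < p \<Longrightarrow> A i p = A p i" and a: "A p p \<noteq> 0"
  shows "quad (Suc p) A s = A p p * (s p + (\<Sum>i<p. A p i * s i) / A p p)^2 + quad p (schur p A) s"
proof -
  define \<beta> where "\<beta> = (\<Sum>i<p. A p i * s i)"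
  have 1: "(\<Sum>i<p. s i * A i p * s p) = \<beta> * s p"
    unfolding \<beta>_def sum_distrib_right by (intro sum.cong) (auto simp: sym)
  have 2: "(\<Sum>i<p. s p * A p i * s i) = \<beta> * s p"
    unfolding \<beta>_def sum_distrib_right by (intro sum.cong) (auto simp: sym)
  have 3: "(\<Sum>i<p. \<Sum>j<p. s i * (A i p * A p j / A p p) * s j) = \<beta> * \<beta> / A p p"
    unfolding \<beta>_def sum_product sum_divide_distrib by (intro sum.cong) (auto simp: sym)
  have 4: "quad p (schur p A) s = quad p A s - \<beta> * \<beta> / A p p"
    unfolding quad_def schur_def 3[symmetric] by (simp add: algebra_simps sum_subtractf)
  have "quad (Suc p) A s = quad p A s + \<beta> * s p + \<beta> * s p + A p p * s p * s p"
    unfolding quad_def using 1 2 by (simp add: sum.distrib)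
  also have "\<dots> = A p p * (s p + \<beta> / A p p)^2 + quad p (schur p A) s"
    unfolding 4 using a by (simp add: power2_eq_square field_simps)
  finally show ?thesis by (simp add: \<beta>_def)
qed

lemma posdef_pos:
  assumes "posdef n A" "i < n" "s i \<noteq> 0"
  shows "quad n A s > 0"
  using assms unfolding posdef_def by blast

lemma posdef_diag:
  assumes "posdef (Suc p) A"
  shows "A p p > 0"
proof -
  define s where "s = (\<lambda>i. if i = p then 1 else 0 :: real)"
  have "quad (Suc p) A s = A p p"
    unfolding quad_def s_def by simp
  moreover have "quad (Suc p) A s > 0"
    by (rule posdef_pos[OF assms, of p]) (simp_all add: s_def)
  ultimately show ?thesis by simp
qed

lemma posdef_sym:
  assumes "posdef n A" "i < n" "j < n"
  shows "A i j = A j i"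
  using assms unfolding posdef_def by blast

lemma posdef_schur:
  assumes A: "posdef (Suc p) A"
  shows "posdef p (schur p A)"
  unfolding posdef_def
proof (intro conjI allI impI)
  note sym = posdef_sym[OF A]
  have symp: "A i p = A p i" if "i < p" for i using sym that by simp
  show "schur p A i j = schur p A j i" if "i < p" "j < p" for i j
    unfolding schur_def using sym[of i j] sym[of i p] sym[of p j] that by simp
  fix s :: "nat \<Rightarrow> real" assume s: "\<exists>i<p. s i \<noteq> 0"
  \<comment> \<open>This last coordinate makes the square in \<open>quad_schur\<close> vanish, so
    that \<open>A\<close> at \<open>s'\<close> takes the value of the Schur complement at
    \<open>s\<close>.\<close>
  define s' where "s' = s(p := - (\<Sum>i<p. A p i * s i) / A p p)"
  from s obtain i where "i < p" "s i \<noteq> 0" by blast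
  then have "quad (Suc p) A s' > 0"
    by (intro posdef_pos[OF A, of i]) (simp_all add: s'_def)
  moreover have "quad p (schur p A) s' = quad p (schur p A) s"
    by (rule quad_cong) (simp add: s'_def)
  moreover have "(\<Sum>i<p. A p i * s' i) = (\<Sum>i<p. A p i * s i)"
    by (rule sum.cong) (auto simp: s'_def)
  ultimately show "0 < quad p (schur p A) s"
    using quad_schur[of p A s', OF symp] posdef_diag[OF A] by (simp add: s'_def)
qed

abbreviation mat_of :: "nat \<Rightarrow> (nat \<Rightarrow> nat \<Rightarrow> 'a) \<Rightarrow> 'a mat" where
  "mat_of p A \<equiv> mat p p (\<lambda>(i, j). A i j)"

text \<open>One step of block elimination: \<open>?U\<close> is unit upper triangular and adds
  multiples of the last row to the others, while \<open>?B\<close> has the pivot as the only nonzero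
  entry of its last column, along which its determinant is expanded.\<close>

lemma det_schur:
  fixes A :: "nat \<Rightarrow> nat \<Rightarrow> 'a::field"
  assumes a: "A p p \<noteq> 0"
  shows "Determinant.det (mat_of (Suc p) A) = A p p * Determinant.det (mat_of p (schur p A))"
proof -
  let ?U = "mat (Suc p) (Suc p) (\<lambda>(i, j). if i = j then 1 else if j = p then A i p / A p p else 0)"
  let ?B = "mat (Suc p) (Suc p) (\<lambda>(i, j). if i < p then if j < p then schur p A i j else 0 else A p j)"
  have "mat_of (Suc p) A = ?U * ?B"
  proof (rule eq_matI)
    fix i j assume ij: "i < dim_row (?U * ?B)" "j < dim_col (?U * ?B)"
    then have ij: "i < Suc p" "j < Suc p" by auto
    have "(?U * ?B) $$ (i, j) = (\<Sum>k<Suc p. ?U $$ (i, k) * ?B $$ (k, j))"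
      using ij by (simp add: scalar_prod_def atLeast0LessThan)
    also have "\<dots> = (\<Sum>k<p. ?U $$ (i, k) * ?B $$ (k, j)) + ?U $$ (i, p) * ?B $$ (p, j)" by simp
    also have "(\<Sum>k<p. ?U $$ (i, k) * ?B $$ (k, j)) = (\<Sum>k<p. if k = i then if j < p then schur p A i j else 0 else 0)"
      by (rule sum.cong) (use ij in auto)
    also have "?U $$ (i, p) * ?B $$ (p, j) = (if i = p then 1 else A i p / A p p) * A p j"
      using ij by simp
    also have "(\<Sum>k<p. if k = i then if j < p then schur p A i j else 0 else 0) =
        (if i < p then if j < p then schur p A i j else 0 else 0)"
      by simp
    also have "\<dots> + (if i = p then 1 else A i p / A p p) * A p j = A i j"
      using ij a by (cases "i < p"; cases "j < p") (auto simp: schur_def less_Suc_eq)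
    finally show "mat_of (Suc p) A $$ (i, j) = (?U * ?B) $$ (i, j)" using ij by simp
  qed auto
  moreover have "Determinant.det (?U * ?B) = Determinant.det ?U * Determinant.det ?B"
    by (rule det_mult) auto
  moreover have "Determinant.det ?U = 1"
    by (subst det_upper_triangular[of _ "Suc p"])
       (auto simp: prod_list_diag_prod)
  moreover have "Determinant.det ?B = A p p * Determinant.det (mat_of p (schur p A))"
  proof -
    have "Determinant.det ?B = (\<Sum>i<Suc p. ?B $$ (i, p) * cofactor ?B i p)"
      by (rule laplace_expansion_column) auto
    also have "\<dots> = A p p * cofactor ?B p p" by simp
    also have "cofactor ?B p p = Determinant.det (mat_of p (schur p A))"
      unfolding cofactor_def
      by (simp add: mat_delete_def, rule arg_cong[where f=Determinant.det], rule eq_matI) auto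
    finally show ?thesis .
  qed
  ultimately show ?thesis by simp
qed

lemma posdef_det_pos: "posdef p A \<Longrightarrow> Determinant.det (mat_of p A) > 0"
proof (induction p arbitrary: A)
  case (Suc p)
  then show ?case using det_schur[of A p] posdef_diag[of p A] posdef_schur[of p A] by simp
qed simp

section \<open>Gaussian integrals in several variables\<close>

text \<open>By coercivity the modulus is at most a product of moduli of one-variable Gaussians with
  parameter \<open>c\<close>. This integrability is what allows one variable to be split off below
  by Fubini.\<close>

lemma gaussian_integrable_multi:
  fixes u :: "nat \<Rightarrow> complex"
  assumes A: "posdef p A"
  shows "integrable (PiM {..<p} (\<lambda>_. lborel))
    (\<lambda>s. exp (- of_real (pi * quad p A s) - 2 * of_real pi * \<i> * (\<Sum>i<p. of_real (s i) * u i)))"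
proof -
  interpret product_sigma_finite "\<lambda>_::nat. lborel :: real measure" by standard
  obtain c where c: "c > 0" "\<And>s. c * (\<Sum>i<p. (s i)^2) \<le> quad p A s"
    using posdef_coercive[OF A] by blast
  let ?g = "\<lambda>i x. exp (- of_real (pi * c * x^2) - 2 * of_real pi * \<i> * of_real x * u i)"
  have g: "integrable lborel (\<lambda>x. norm (?g i x))" for i
  proof (rule integrable_norm)
    show "integrable lborel (?g i)"
      using gaussian_integral_complex[OF c(1), of "u i"] unfolding has_bochner_integral_iff
      by (rule conjunct1)
  qed
  have "integrable (PiM {..<p} (\<lambda>_. lborel)) (\<lambda>s. \<Prod>i<p. norm (?g i (s i)))"
    by (rule product_integrable_prod[OF finite_lessThan g])
  then show ?thesis
  proof (rule Bochner_Integration.integrable_bound)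
    show "(\<lambda>s. exp (- of_real (pi * quad p A s) - 2 * of_real pi * \<i> * (\<Sum>i<p. of_real (s i) * u i)))
      \<in> borel_measurable (PiM {..<p} (\<lambda>_. lborel))"
      unfolding quad_def by measurable
    have "norm (exp (- of_real (pi * quad p A s) - 2 * of_real pi * \<i> * (\<Sum>i<p. of_real (s i) * u i)))
       \<le> norm (\<Prod>i<p. norm (?g i (s i)))" for s
    proof -
      have "(\<Prod>i<p. norm (?g i (s i))) = norm (exp (\<Sum>i<p. - of_real (pi * c * (s i)^2) - 2 * of_real pi * \<i> * of_real (s i) * u i))"
        by (simp only: exp_sum[OF finite_lessThan] prod_norm)
      also have "\<dots> = exp (- pi * (c * (\<Sum>i<p. (s i)^2)) + (\<Sum>i<p. 2 * pi * s i * Im (u i)))"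
        unfolding norm_exp_eq_Re
        by (simp add: sum_distrib_left sum_subtractf sum_negf algebra_simps flip: sum.distrib)
      finally have 1: "(\<Prod>i<p. norm (?g i (s i))) = \<dots>" .
      have "norm (exp (- of_real (pi * quad p A s) - 2 * of_real pi * \<i> * (\<Sum>i<p. of_real (s i) * u i)))
        = exp (- pi * quad p A s + (\<Sum>i<p. 2 * pi * s i * Im (u i)))"
        by (simp add: norm_exp_eq_Re sum_distrib_left sum_negf algebra_simps)
      then show ?thesis unfolding 1 using c(2)[of s] by simp
    qed
    then show "AE s in PiM {..<p} (\<lambda>_. lborel). norm (exp (- of_real (pi * quad p A s) - 2 * of_real pi * \<i> * (\<Sum>i<p. of_real (s i) * u i)))
       \<le> norm (\<Prod>i<p. norm (?g i (s i)))" by simp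
  qed
qed

text \<open>The linear coefficient is written as \<open>A v\<close>, so that no inverse matrix occurs and the form is
  preserved by taking Schur complements.\<close>

lemma gaussian_integral_multi:
  fixes v :: "nat \<Rightarrow> complex"
  assumes "posdef p A"
  shows "(LINT s|PiM {..<p} (\<lambda>_. lborel).
      exp (- of_real (pi * quad p A s) - 2 * of_real pi * \<i> * (\<Sum>i<p. of_real (s i) * (\<Sum>j<p. of_real (A i j) * v j))))
    = exp (- of_real pi * quad p (\<lambda>i j. of_real (A i j)) v) / of_real (sqrt (Determinant.det (mat_of p A)))"
  using assms
proof (induction p arbitrary: A)
  case 0
  interpret product_sigma_finite "\<lambda>_::nat. lborel :: real measure" by standard
  show ?case by (simp add: PiM_empty quad_def)
next
  case (Suc p)
  interpret product_sigma_finite "\<lambda>_::nat. lborel :: real measure" by standard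
  define a where "a = A p p"
  have a: "a > 0" unfolding a_def by (rule posdef_diag[OF Suc.prems])
  note sym = posdef_sym[OF Suc.prems]
  have symp: "A i p = A p i" if "i < p" for i using sym that by simp
  define u where "u i = (\<Sum>j<Suc p. of_real (A i j) * v j)" for i
  define B where "B = schur p A"
  have B: "posdef p B" unfolding B_def by (rule posdef_schur[OF Suc.prems])
  have det: "Determinant.det (mat_of (Suc p) A) = a * Determinant.det (mat_of p B)"
    unfolding a_def B_def using a a_def by (intro det_schur) simp
  define E where "E q M w s = exp (- of_real (pi * quad q M s) - 2 * of_real pi * \<i> * (\<Sum>i<q. complex_of_real (s i) * w i))"
    for q M w s
  \<comment> \<open>\<open>v p\<close> is eliminated between rows \<open>i\<close> and
    \<open>p\<close> of \<open>A v\<close>; what remains is row \<open>i\<close> of the Schur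
    complement applied to the same \<open>v\<close>.\<close>
  have uB: "u i - of_real (A p i) * u p / of_real a = (\<Sum>j<p. of_real (B i j) * v j)" if "i < p" for i
  proof -
    have "(\<Sum>j<p. of_real (B i j) * v j) = (\<Sum>j<p. of_real (A i j) * v j) - of_real (A p i) / of_real a * (\<Sum>j<p. of_real (A p j) * v j)"
      using symp[of i] that by (simp add: B_def schur_def a_def algebra_simps sum_subtractf sum_distrib_left)
    moreover have "u i = (\<Sum>j<p. of_real (A i j) * v j) + of_real (A p i) * v p"
      using symp[of i] that by (simp add: u_def)
    moreover have "u p = (\<Sum>j<p. of_real (A p j) * v j) + of_real a * v p"
      by (simp add: u_def a_def)
    ultimately show ?thesis using a by (simp add: field_simps)
  qed
  have int: "integrable (PiM (insert p {..<p}) (\<lambda>_. lborel)) (E (Suc p) A u)"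
    using gaussian_integrable_multi[OF Suc.prems, of u] unfolding E_def lessThan_Suc .
  have inner: "(LINT y|lborel. E (Suc p) A u (x(p := y))) =
     exp (- of_real pi * (u p)^2 / of_real a) / of_real (sqrt a) * E p B (\<lambda>i. \<Sum>j<p. of_real (B i j) * v j) x" for x
  proof -
    define \<beta> where "\<beta> = (\<Sum>i<p. A p i * x i)"
    define K where "K = - complex_of_real (pi * \<beta>^2 / a) - of_real (pi * quad p B x) - 2 * of_real pi * \<i> * (\<Sum>i<p. of_real (x i) * u i)"
    have q: "quad (Suc p) A (x(p := y)) = a * (y + \<beta> / a)^2 + quad p B x" for y
    proof -
      have "quad (Suc p) A (x(p := y)) = A p p * ((x(p := y)) p + (\<Sum>i<p. A p i * (x(p := y)) i) / A p p)^2
          + quad p (schur p A) (x(p := y))"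
        by (rule quad_schur) (use symp a a_def in auto)
      moreover have "(\<Sum>i<p. A p i * (x(p := y)) i) = \<beta>" unfolding \<beta>_def by (rule sum.cong) auto
      moreover have "quad p (schur p A) (x(p := y)) = quad p B x" unfolding B_def by (rule quad_cong) auto
      ultimately show ?thesis by (simp add: a_def)
    qed
    \<comment> \<open>The real cross term 2 y \<beta> of the quadratic form is absorbed into the
      linear coefficient of the one-variable Gaussian, which thereby becomes
      \<open>u p - \<i> * of_real \<beta>\<close>.\<close>
    have "E (Suc p) A u (x(p := y)) =
       exp K * exp (- of_real (pi * a * y^2) - 2 * of_real pi * \<i> * of_real y * (u p - \<i> * of_real \<beta>))" for y
    proof -
      have s: "(\<Sum>i<Suc p. complex_of_real ((x(p := y)) i) * u i) = (\<Sum>i<p. of_real (x i) * u i) + of_real y * u p"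
        by simp
      have r: "a * (y + \<beta> / a)^2 = a * y^2 + 2 * y * \<beta> + \<beta>^2 / a"
        using a by (simp add: power2_eq_square field_simps)
      show ?thesis unfolding E_def q s exp_add[symmetric] r K_def
        by (rule arg_cong[where f=exp]) (simp add: algebra_simps)
    qed
    then have "(LINT y|lborel. E (Suc p) A u (x(p := y))) =
      exp K * (exp (- of_real pi * (u p - \<i> * of_real \<beta>)^2 / of_real a) / of_real (sqrt a))"
      using gaussian_integral_complex[OF a, of "u p - \<i> * of_real \<beta>"]
      by (simp add: has_bochner_integral_iff)
    also have "\<dots> = exp (K + - of_real pi * (u p - \<i> * of_real \<beta>)^2 / of_real a) / of_real (sqrt a)"
      by (simp only: exp_add times_divide_eq_right)
    also have "K + - of_real pi * (u p - \<i> * of_real \<beta>)^2 / of_real a = - of_real pi * (u p)^2 / of_real a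
       + (- of_real (pi * quad p B x) - 2 * of_real pi * \<i> * (\<Sum>i<p. of_real (x i) * (\<Sum>j<p. of_real (B i j) * v j)))"
    proof -
      define X Y where "X = (\<Sum>i<p. of_real (x i) * (\<Sum>j<p. of_real (B i j) * v j))"
        and "Y = (\<Sum>i<p. of_real (x i) * u i)"
      have "X = (\<Sum>i<p. of_real (x i) * (u i - of_real (A p i) * u p / of_real a))"
        unfolding X_def by (intro sum.cong) (auto simp: uB)
      also have "\<dots> = Y - of_real \<beta> * u p / of_real a"
        unfolding \<beta>_def Y_def by (simp add: algebra_simps sum_subtractf sum_distrib_left sum_divide_distrib)
      finally have X: "X = Y - of_real \<beta> * u p / of_real a" .
      show ?thesis using a unfolding K_def X_def[symmetric] Y_def[symmetric] X
        by (simp add: field_simps power2_eq_square)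
    qed
    finally show ?thesis unfolding E_def exp_add by simp
  qed
  have "(LINT s|PiM {..<Suc p} (\<lambda>_. lborel). E (Suc p) A u s) =
     (LINT x|PiM {..<p} (\<lambda>_. lborel). LINT y|lborel. E (Suc p) A u (x(p := y)))"
    unfolding lessThan_Suc by (rule product_integral_insert) (use int in auto)
  also have "\<dots> = exp (- of_real pi * (u p)^2 / of_real a) / of_real (sqrt a) *
     (exp (- of_real pi * quad p (\<lambda>i j. of_real (B i j)) v) / of_real (sqrt (Determinant.det (mat_of p B))))"
    unfolding inner by (simp add: Suc.IH[OF B, folded E_def])
  also have "\<dots> = exp (- of_real pi * ((u p)^2 / of_real a + quad p (\<lambda>i j. of_real (B i j)) v))
       / of_real (sqrt (Determinant.det (mat_of (Suc p) A)))"
    unfolding det by (simp add: real_sqrt_mult algebra_simps flip: exp_add)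
  \<comment> \<open>As \<open>u p\<close> is row \<open>p\<close> of \<open>A v\<close>, the first
    summand is the completed square of \<open>quad_schur\<close> at \<open>v\<close>.\<close>
  also have "(u p)^2 / of_real a + quad p (\<lambda>i j. of_real (B i j)) v = quad (Suc p) (\<lambda>i j. of_real (A i j)) v"
  proof -
    have "quad (Suc p) (\<lambda>i j. of_real (A i j)) v = of_real a * (v p + (\<Sum>i<p. of_real (A p i) * v i) / of_real a)^2
      + quad p (schur p (\<lambda>i j. of_real (A i j))) v"
      unfolding a_def by (rule quad_schur) (use symp a a_def in auto)
    moreover have "schur p (\<lambda>i j. complex_of_real (A i j)) = (\<lambda>i j. of_real (B i j))"
      by (intro ext) (simp add: schur_def B_def)
    moreover have "(u p)^2 / of_real a = of_real a * (v p + (\<Sum>i<p. of_real (A p i) * v i) / of_real a)^2"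
      using a by (simp add: u_def a_def[symmetric] power2_eq_square field_simps)
    ultimately show ?thesis by simp
  qed
  finally show ?case unfolding E_def u_def .
qed

section \<open>Discreteness of the lattice\<close>

lemma openin_prod_topologyE:
  assumes "openin (prod_topology X Y) S" "(x, y) \<in> S"
  obtains A B where "openin X A" "x \<in> A" "openin Y B" "y \<in> B" "A \<times> B \<subseteq> S"
  using assms unfolding openin_prod_topology_alt by blast

lemma openin_vec_topologyE:
  assumes "openin (vec_topology n X) U" "v \<in> U"
  obtains V where "\<And>i. i < n \<Longrightarrow> openin X (V i)" "\<And>i. i < n \<Longrightarrow> vec_index v i \<in> V i"
    "\<And>w. w \<in> carrier_vec n \<Longrightarrow> (\<And>i. i < n \<Longrightarrow> vec_index w i \<in> V i) \<Longrightarrow> w \<in> U"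
proof -
  obtain W where W: "openin (product_topology (\<lambda>_. X) {..<n}) W"
    "U = (\<lambda>v. \<lambda>i\<in>{..<n}. vec_index v i) -` W \<inter> carrier_vec n"
    using assms(1) unfolding vec_topology_def openin_pullback_topology by auto
  then have "(\<lambda>i\<in>{..<n}. vec_index v i) \<in> W" using assms(2) by auto
  with W(1) obtain V where V: "\<And>i. i < n \<Longrightarrow> openin X (V i)"
    "(\<lambda>i\<in>{..<n}. vec_index v i) \<in> PiE {..<n} V" "PiE {..<n} V \<subseteq> W"
    unfolding openin_product_topology_alt by (metis lessThan_iff)
  show ?thesis
  proof (rule that)
    fix w assume w: "w \<in> carrier_vec n" "\<And>i. i < n \<Longrightarrow> vec_index w i \<in> V i"
    then have "(\<lambda>i\<in>{..<n}. vec_index w i) \<in> PiE {..<n} V" by auto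
    then have "(\<lambda>i\<in>{..<n}. vec_index w i) \<in> W" by (rule subsetD[OF V(3)])
    then show "w \<in> U" using w(1) by (simp add: W(2))
  next
    show "vec_index v i \<in> V i" if "i < n" for i
      using V(2) that by (auto simp: PiE_iff)
  qed (use V in auto)
qed

lemma open_real_uniform_nbhd:
  fixes V :: "nat \<Rightarrow> real set"
  assumes "\<And>i. i < n \<Longrightarrow> open (V i)" "\<And>i. i < n \<Longrightarrow> 0 \<in> V i"
  obtains e where "e > 0" "\<And>i x. i < n \<Longrightarrow> \<bar>x\<bar> < e \<Longrightarrow> x \<in> V i"
proof -
  have "\<exists>e. \<forall>i<n. e i > 0 \<and> (\<forall>x. \<bar>x\<bar> < e i \<longrightarrow> x \<in> V i)"
  proof -
    have "\<exists>e>0. \<forall>x. \<bar>x\<bar> < e \<longrightarrow> x \<in> V i" if "i < n" for i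
      using assms(1,2)[OF that] unfolding open_dist dist_real_def by (metis diff_zero)
    then show ?thesis by metis
  qed
  then obtain e where e: "\<And>i. i < n \<Longrightarrow> e i > 0" "\<And>i x. i < n \<Longrightarrow> \<bar>x\<bar> < e i \<Longrightarrow> x \<in> V i" by blast
  show ?thesis
    \<comment> \<open>The inserted 1 keeps the set nonempty when \<open>n = 0\<close>.\<close>
    by (rule that[of "Min (insert 1 (e ` {..<n}))"]) (use e in auto)
qed

lemma mod1_eq_iff: "mod1 x = mod1 y \<longleftrightarrow> x - y \<in> \<int>"
proof
  assume "mod1 x = mod1 y"
  moreover have "x \<in> mod1 x" by (simp add: mod1_def)
  ultimately show "x - y \<in> \<int>" by (simp add: mod1_def)
next
  assume *: "x - y \<in> \<int>"
  have "z - x \<in> \<int> \<longleftrightarrow> z - y \<in> \<int>" for z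
    using Ints_add[OF _ *, of "z - x"] Ints_diff[OF _ *, of "z - y"] by auto
  then show "mod1 x = mod1 y" unfolding mod1_def by simp
qed

text \<open>The integer component is kept equal to 0, since a neighbourhood in the discrete factor
  may contain nothing else; the last component need only be near integers, since it is read modulo
  1.\<close>

lemma phase_topology_nbhd_zero:
  assumes U: "openin (phase_topology p q) U" and z: "reduce (0\<^sub>v p, 0\<^sub>v p, 0\<^sub>v q, 0\<^sub>v q) \<in> U"
  obtains e where "e > 0"
    "\<And>w1 w2 r. w1 \<in> carrier_vec p \<Longrightarrow> w2 \<in> carrier_vec p \<Longrightarrow> r \<in> carrier_vec q \<Longrightarrow>
      (\<And>i. i < p \<Longrightarrow> \<bar>vec_index w1 i\<bar> < e) \<Longrightarrow> (\<And>i. i < p \<Longrightarrow> \<bar>vec_index w2 i\<bar> < e) \<Longrightarrow>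
      (\<And>i. i < q \<Longrightarrow> \<exists>k\<in>\<int>. \<bar>vec_index r i - k\<bar> < e) \<Longrightarrow> reduce (w1, w2, 0\<^sub>v q, r) \<in> U"
proof -
  obtain U1 U2 U3 U4 where U1: "openin (vec_topology p euclideanreal) U1" "0\<^sub>v p \<in> U1"
    and U2: "openin (vec_topology p euclideanreal) U2" "0\<^sub>v p \<in> U2"
    and U3: "openin (vec_topology q (discrete_topology (UNIV :: int set))) U3" "0\<^sub>v q \<in> U3"
    and U4: "openin (vec_topology q circle) U4" "map_vec mod1 (0\<^sub>v q) \<in> U4"
    and sub: "U1 \<times> U2 \<times> U3 \<times> U4 \<subseteq> U"
  proof -
    have "(0\<^sub>v p, 0\<^sub>v p, 0\<^sub>v q, map_vec mod1 (0\<^sub>v q)) \<in> U" using z by (simp add: reduce_def)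
    from openin_prod_topologyE[OF U[unfolded phase_topology_def] this]
    obtain A B where A: "openin (vec_topology p euclideanreal) A" "0\<^sub>v p \<in> A"
      and B: "openin (prod_topology (vec_topology p euclideanreal)
         (prod_topology (vec_topology q (discrete_topology UNIV)) (vec_topology q circle))) B"
        "(0\<^sub>v p, 0\<^sub>v q, map_vec mod1 (0\<^sub>v q)) \<in> B"
      and AB: "A \<times> B \<subseteq> U" .
    from openin_prod_topologyE[OF B]
    obtain C D where C: "openin (vec_topology p euclideanreal) C" "0\<^sub>v p \<in> C"
      and D: "openin (prod_topology (vec_topology q (discrete_topology UNIV)) (vec_topology q circle)) D"
        "(0\<^sub>v q, map_vec mod1 (0\<^sub>v q)) \<in> D"
      and CD: "C \<times> D \<subseteq> B" .
    from openin_prod_topologyE[OF D]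
    obtain E F where E: "openin (vec_topology q (discrete_topology (UNIV :: int set))) E" "0\<^sub>v q \<in> E"
      and F: "openin (vec_topology q circle) F" "map_vec mod1 (0\<^sub>v q) \<in> F"
      and EF: "E \<times> F \<subseteq> D" .
    have "A \<times> C \<times> E \<times> F \<subseteq> U" using AB CD EF by blast
    then show ?thesis by (rule that[OF A C E F])
  qed
  obtain V1 where V1: "\<And>i. i < p \<Longrightarrow> openin euclideanreal (V1 i)" "\<And>i. i < p \<Longrightarrow> vec_index (0\<^sub>v p) i \<in> V1 i"
    "\<And>w. w \<in> carrier_vec p \<Longrightarrow> (\<And>i. i < p \<Longrightarrow> vec_index w i \<in> V1 i) \<Longrightarrow> w \<in> U1"
    using openin_vec_topologyE[OF U1] by metis
  obtain V2 where V2: "\<And>i. i < p \<Longrightarrow> openin euclideanreal (V2 i)" "\<And>i. i < p \<Longrightarrow> vec_index (0\<^sub>v p) i \<in> V2 i"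
    "\<And>w. w \<in> carrier_vec p \<Longrightarrow> (\<And>i. i < p \<Longrightarrow> vec_index w i \<in> V2 i) \<Longrightarrow> w \<in> U2"
    using openin_vec_topologyE[OF U2] by metis
  obtain V4 where V4: "\<And>i. i < q \<Longrightarrow> openin circle (V4 i)" "\<And>i. i < q \<Longrightarrow> vec_index (map_vec mod1 (0\<^sub>v q)) i \<in> V4 i"
    "\<And>w. w \<in> carrier_vec q \<Longrightarrow> (\<And>i. i < q \<Longrightarrow> vec_index w i \<in> V4 i) \<Longrightarrow> w \<in> U4"
    using openin_vec_topologyE[OF U4] by metis
  obtain e1 where e1: "e1 > 0" "\<And>i x. i < p \<Longrightarrow> \<bar>x\<bar> < e1 \<Longrightarrow> x \<in> V1 i"
    using open_real_uniform_nbhd[of p V1] V1 by auto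
  obtain e2 where e2: "e2 > 0" "\<And>i x. i < p \<Longrightarrow> \<bar>x\<bar> < e2 \<Longrightarrow> x \<in> V2 i"
    using open_real_uniform_nbhd[of p V2] V2 by auto
  \<comment> \<open>Openness in the quotient is openness of the preimage under \<open>mod1\<close>,
    which brings the question back to the real line.\<close>
  obtain e4 where e4: "e4 > 0" "\<And>i x. i < q \<Longrightarrow> \<bar>x\<bar> < e4 \<Longrightarrow> x \<in> mod1 -` V4 i"
    using open_real_uniform_nbhd[of q "\<lambda>i. mod1 -` V4 i"] V4(1,2)
    unfolding circle_def openin_quotient_topology by (auto simp: vimage_def)
  show ?thesis
  proof (rule that[of "min e1 (min e2 e4)"])
    fix w1 w2 r
    assume c: "w1 \<in> carrier_vec p" "w2 \<in> carrier_vec p" "r \<in> carrier_vec q"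
      and b: "\<And>i. i < p \<Longrightarrow> \<bar>vec_index w1 i\<bar> < min e1 (min e2 e4)"
        "\<And>i. i < p \<Longrightarrow> \<bar>vec_index w2 i\<bar> < min e1 (min e2 e4)"
        "\<And>i. i < q \<Longrightarrow> \<exists>k\<in>\<int>. \<bar>vec_index r i - k\<bar> < min e1 (min e2 e4)"
    have "w1 \<in> U1" using b(1) by (intro V1(3) c e1) auto
    moreover have "w2 \<in> U2" using b(2) by (intro V2(3) c e2) auto
    moreover have "map_vec mod1 r \<in> U4"
    proof (rule V4(3))
      fix i assume i: "i < q"
      then obtain k where k: "k \<in> \<int>" "\<bar>vec_index r i - k\<bar> < e4" using b(3) by auto
      then have "mod1 (vec_index r i - k) \<in> V4 i" using e4(2) i by auto
      moreover have "mod1 (vec_index r i - k) = mod1 (vec_index r i)"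
        using k(1) by (simp add: mod1_eq_iff)
      ultimately show "vec_index (map_vec mod1 r) i \<in> V4 i" using i c by simp
    qed (use c in simp)
    ultimately show "reduce (w1, w2, 0\<^sub>v q, r) \<in> U" using sub U3 by (auto simp: reduce_def)
  qed (use e1 e2 e4 in auto)
qed

text \<open>Pigeonhole: only finitely many cubes of side \<open>e\<close> meet the box of radius
  \<open>B\<close>, and two points in one cube differ by less than \<open>e\<close> in every
  coordinate.\<close>

lemma infinite_range_close_pair:
  fixes f :: "'a \<Rightarrow> nat \<Rightarrow> real"
  assumes inf: "infinite Y" and B: "\<And>y i. y \<in> Y \<Longrightarrow> i < n \<Longrightarrow> \<bar>f y i\<bar> \<le> B" and e: "e > 0"
  obtains y z where "y \<in> Y" "z \<in> Y" "y \<noteq> z" "\<And>i. i < n \<Longrightarrow> \<bar>f y i - f z i\<bar> < e"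
proof -
  define c where "c y = (\<lambda>i\<in>{..<n}. \<lfloor>f y i / e\<rfloor>)" for y
  have "c ` Y \<subseteq> PiE {..<n} (\<lambda>_. {\<lfloor>- B / e\<rfloor>..\<lfloor>B / e\<rfloor>})"
  proof (rule image_subsetI)
    fix y assume y: "y \<in> Y"
    have "\<lfloor>- B / e\<rfloor> \<le> \<lfloor>f y i / e\<rfloor>" "\<lfloor>f y i / e\<rfloor> \<le> \<lfloor>B / e\<rfloor>" if "i < n" for i
      using B[OF y that] e by (intro floor_mono divide_right_mono; linarith)+
    then show "c y \<in> PiE {..<n} (\<lambda>_. {\<lfloor>- B / e\<rfloor>..\<lfloor>B / e\<rfloor>})"
      unfolding c_def by simp
  qed
  moreover have "finite (PiE {..<n} (\<lambda>_. {\<lfloor>- B / e\<rfloor>..\<lfloor>B / e\<rfloor>}))" by (intro finite_PiE) auto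
  ultimately have "finite (c ` Y)" by (rule finite_subset)
  then have "\<not> inj_on c Y" using inf finite_imageD by blast
  then obtain y z where yz: "y \<in> Y" "z \<in> Y" "y \<noteq> z" "c y = c z" unfolding inj_on_def by blast
  have "\<bar>f y i - f z i\<bar> < e" if "i < n" for i
  proof -
    have "\<lfloor>f y i / e\<rfloor> = \<lfloor>f z i / e\<rfloor>"
      using fun_cong[OF yz(4), of i] that by (simp add: c_def)
    then have "\<bar>f y i / e - f z i / e\<bar> < 1" by linarith
    then show ?thesis using e by (simp add: abs_less_iff field_simps)
  qed
  with yz that show ?thesis by blast
qed

text \<open>\<open>embed\<close> accepts only integer vectors; this form also admits the real
  vectors needed for the kernel and for coercivity.\<close>

definition lin :: "nat \<Rightarrow> real mat \<Rightarrow> (nat \<Rightarrow> real) \<Rightarrow> nat \<Rightarrow> real" where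
  "lin d \<Phi> x i = (\<Sum>j<d. \<Phi> $$ (i, j) * x j)"

lemma lin_diff: "lin d \<Phi> (\<lambda>j. x j - y j) i = lin d \<Phi> x i - lin d \<Phi> y i"
  by (simp add: lin_def algebra_simps sum_subtractf)

lemma lin_scale: "lin d \<Phi> (\<lambda>j. t * x j) i = t * lin d \<Phi> x i"
  by (simp add: lin_def sum_distrib_left algebra_simps)

lemma embed_lin:
  assumes "\<Phi> \<in> carrier_mat (2 * p + 2 * q) (2 * p + q)" "x \<in> carrier_vec (2 * p + q)"
  shows "embed p q \<Phi> x = (let L = lin (2 * p + q) \<Phi> (\<lambda>j. real_of_int (vec_index x j)) in
    (vec p L, vec p (\<lambda>i. L (p + i)), vec q (\<lambda>i. \<lfloor>L (2 * p + i)\<rfloor>), vec q (\<lambda>i. L (2 * p + q + i))))"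
proof -
  have "vec_index (\<Phi> *\<^sub>v map_vec real_of_int x) i = lin (2 * p + q) \<Phi> (\<lambda>j. real_of_int (vec_index x j)) i"
    if "i < 2 * p + 2 * q" for i
    using assms that by (simp add: lin_def scalar_prod_def row_def atLeast0LessThan)
  then show ?thesis
    unfolding embed_def Let_def by (auto intro!: eq_vecI)
qed

lemma lin_integer_row:
  assumes "lattice_embedding p q \<Phi>" "i \<in> {2 * p..<2 * p + q}" "\<And>j. j < 2 * p + q \<Longrightarrow> x j \<in> \<int>"
  shows "lin (2 * p + q) \<Phi> x i \<in> \<int>"
  using assms unfolding lattice_embedding_def lin_def by (intro Ints_sum Ints_mult) auto

text \<open>Supplies infinitely many distinct integer points along the line through a vector with a
  nonzero coordinate.\<close>

lemma infinite_floor_multiples: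
  fixes a :: real
  assumes "a \<noteq> 0"
  shows "infinite (range (\<lambda>t::nat. \<lfloor>real t * a\<rfloor>))"
proof
  assume "finite (range (\<lambda>t::nat. \<lfloor>real t * a\<rfloor>))"
  then obtain M where "abs ` range (\<lambda>t::nat. \<lfloor>real t * a\<rfloor>) \<subseteq> {..M}"
    unfolding finite_int_iff_bounded_le by blast
  then have M: "\<bar>\<lfloor>real t * a\<rfloor>\<bar> \<le> M" for t :: nat by auto
  obtain t :: nat where "real_of_int M + 1 < real t * \<bar>a\<bar>"
    using reals_Archimedean3[of "\<bar>a\<bar>"] assms by auto
  also have "\<dots> = \<bar>real t * a\<bar>" by (simp add: abs_mult)
  also have "\<dots> \<le> real_of_int M + 1" using M[of t] by linarith
  finally show False by simp
qed

text \<open>Integer points near the line spanned by a kernel vector of the first \<open>2p + q\<close> rows have bounded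
  image modulo the last \<open>q\<close> coordinates, so by pigeonhole some nonzero differences of them are mapped
  arbitrarily close to zero, against discreteness.\<close>

lemma lattice_embedding_kernel_trivial:
  assumes lat: "lattice_embedding p q \<Phi>"
    and ker: "\<And>i. i < 2 * p + q \<Longrightarrow> lin (2 * p + q) \<Phi> x i = 0"
    and j: "j < 2 * p + q"
  shows "x j = 0"
proof (rule ccontr)
  assume xj: "x j \<noteq> 0"
  define d where "d = 2 * p + q"
  note lat' = lat[unfolded lattice_embedding_def]
  have \<Phi>: "\<Phi> \<in> carrier_mat (2 * p + 2 * q) (2 * p + q)" using lat' by blast
  let ?D = "reduce ` lattice_pts p q \<Phi>"
  let ?Z = "reduce (0\<^sub>v p, 0\<^sub>v p, 0\<^sub>v q, 0\<^sub>v q)"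
  have embed0: "embed p q \<Phi> (0\<^sub>v (2 * p + q)) = (0\<^sub>v p, 0\<^sub>v p, 0\<^sub>v q, 0\<^sub>v q)"
    by (auto simp: embed_lin[OF \<Phi>] Let_def lin_def intro!: eq_vecI)
  have Z: "?Z \<in> ?D"
    unfolding lattice_pts_def using embed0 by (metis imageI zero_carrier_vec)
  have "subtopology (phase_topology p q) ?D = discrete_topology ?D"
    using lat' unfolding lattice_in_def by blast
  then have "openin (subtopology (phase_topology p q) ?D) {?Z}"
    using Z by simp
  \<comment> \<open>By discreteness, the origin is the only lattice point in
    \<open>U\<close>.\<close>
  then obtain U where U: "openin (phase_topology p q) U" "{?Z} = U \<inter> ?D"
    unfolding openin_subtopology by blast
  have "?Z \<in> U" using U(2) by blast
  from phase_topology_nbhd_zero[OF U(1) this] obtain e where e: "e > 0"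
    "\<And>w1 w2 r. w1 \<in> carrier_vec p \<Longrightarrow> w2 \<in> carrier_vec p \<Longrightarrow> r \<in> carrier_vec q \<Longrightarrow>
      (\<And>i. i < p \<Longrightarrow> \<bar>vec_index w1 i\<bar> < e) \<Longrightarrow> (\<And>i. i < p \<Longrightarrow> \<bar>vec_index w2 i\<bar> < e) \<Longrightarrow>
      (\<And>i. i < q \<Longrightarrow> \<exists>k\<in>\<int>. \<bar>vec_index r i - k\<bar> < e) \<Longrightarrow> reduce (w1, w2, 0\<^sub>v q, r) \<in> U"
    by metis
  define y where "y t = vec d (\<lambda>j. \<lfloor>real t * x j\<rfloor>)" for t :: nat
  define L where "L v = lin d \<Phi> (\<lambda>j. real_of_int (vec_index v j))" for v
  \<comment> \<open>The kernel condition bounds only the first \<open>d\<close> coordinates; the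
    others are replaced by fractional parts, which are bounded and determine the point of the
    torus.\<close>
  define f where "f v i = (if i < d then L v i else frac (L v i))" for v i
  \<comment> \<open>The 1 bounds the fractional parts; the double sum dominates every absolute row
    sum among the first \<open>d\<close> rows.\<close>
  define B where "B = 1 + (\<Sum>i<d. \<Sum>j<d. \<bar>\<Phi> $$ (i, j)\<bar>)"
  have inf: "infinite (range y)"
  proof
    assume "finite (range y)"
    then have "finite ((\<lambda>v. vec_index v j) ` range y)" by (rule finite_imageI)
    moreover have "(\<lambda>v. vec_index v j) ` range y = range (\<lambda>t::nat. \<lfloor>real t * x j\<rfloor>)"
      using j unfolding image_image by (simp add: y_def d_def)
    ultimately show False using infinite_floor_multiples[OF xj] by simp
  qed
  have bd: "\<bar>f v i\<bar> \<le> B" if v: "v \<in> range y" and "i < 2 * p + 2 * q" for v i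
  proof (cases "i < d")
    case True
    obtain t where t: "v = y t" using v by blast
    \<comment> \<open>Since t x lies in the kernel, only the rounding error contributes, and it is
      at most 1 in each coordinate.\<close>
    have "L v i = lin d \<Phi> (\<lambda>j. real_of_int (vec_index v j) - real t * x j) i"
      unfolding lin_diff lin_scale L_def using ker[of i] True by (simp add: d_def)
    also have "\<bar>\<dots>\<bar> \<le> (\<Sum>j<d. \<bar>\<Phi> $$ (i, j)\<bar>)"
      unfolding lin_def
    proof (rule order_trans[OF sum_abs], rule sum_mono)
      fix j assume "j \<in> {..<d}"
      then have "vec_index v j = \<lfloor>real t * x j\<rfloor>" by (simp add: t y_def)
      then have "\<bar>real_of_int (vec_index v j) - real t * x j\<bar> \<le> 1" by linarith
      then show "\<bar>\<Phi> $$ (i, j) * (real_of_int (vec_index v j) - real t * x j)\<bar> \<le> \<bar>\<Phi> $$ (i, j)\<bar>"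
        unfolding abs_mult by (rule mult_left_le) simp
    qed
    also have "\<dots> \<le> (\<Sum>i<d. \<Sum>j<d. \<bar>\<Phi> $$ (i, j)\<bar>)"
      using True by (intro member_le_sum sum_nonneg) auto
    finally show ?thesis using True by (simp add: f_def B_def)
  next
    case False
    have "0 \<le> (\<Sum>i<d. \<Sum>j<d. \<bar>\<Phi> $$ (i, j)\<bar>)" by (intro sum_nonneg) simp
    then show ?thesis using False frac_ge_0[of "L v i"] frac_lt_1[of "L v i"]
      by (simp add: f_def B_def)
  qed
  \<comment> \<open>Closeness below \<open>e\<close> puts the difference into \<open>U\<close>;
    closeness below 1 makes its integer rows vanish exactly.\<close>
  have e1: "min e 1 > 0" using e(1) by simp
  obtain v w where vw: "v \<in> range y" "w \<in> range y" "v \<noteq> w"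
    "\<And>i. i < 2 * p + 2 * q \<Longrightarrow> \<bar>f v i - f w i\<bar> < min e 1"
  proof (rule infinite_range_close_pair[OF inf _ e1])
    show "\<bar>f v i\<bar> \<le> B" if "v \<in> range y" "i < 2 * p + 2 * q" for v i
      using that by (rule bd)
  qed (rule that)
  have car: "v \<in> carrier_vec d" "w \<in> carrier_vec d" using vw by (auto simp: y_def)
  then have car': "v - w \<in> carrier_vec (2 * p + q)" by (simp add: d_def)
  have L: "lin (2 * p + q) \<Phi> (\<lambda>j. real_of_int (vec_index (v - w) j)) i = L v i - L w i" for i
  proof -
    have "L v i - L w i = lin d \<Phi> (\<lambda>j. real_of_int (vec_index v j) - real_of_int (vec_index w j)) i"
      by (simp add: L_def lin_diff)
    also have "\<dots> = lin d \<Phi> (\<lambda>j. real_of_int (vec_index (v - w) j)) i"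
      unfolding lin_def by (rule sum.cong) (use car in auto)
    finally show ?thesis by (simp add: d_def)
  qed
  have m: "\<lfloor>L v (2 * p + i) - L w (2 * p + i)\<rfloor> = 0" if "i < q" for i
  proof -
    have "L v (2 * p + i) - L w (2 * p + i) \<in> \<int>"
      unfolding L_def d_def by (intro Ints_diff lin_integer_row[OF lat]) (use that in auto)
    moreover have "\<bar>L v (2 * p + i) - L w (2 * p + i)\<bar> < 1"
      using vw(4)[of "2 * p + i"] that by (simp add: f_def d_def)
    ultimately have "L v (2 * p + i) - L w (2 * p + i) = 0" by (metis Ints_nonzero_abs_less1)
    then show ?thesis by simp
  qed
  have close: "\<bar>L v i - L w i\<bar> < e" if "i < 2 * p + q" for i
    using vw(4)[of i] that by (simp add: f_def d_def)
  have "reduce (embed p q \<Phi> (v - w)) = reduce (vec p (\<lambda>i. L v i - L w i), vec p (\<lambda>i. L v (p + i) - L w (p + i)), 0\<^sub>v q,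
      vec q (\<lambda>i. L v (2 * p + q + i) - L w (2 * p + q + i)))"
    unfolding embed_lin[OF \<Phi> car'] Let_def L using m
    by (intro arg_cong[where f=reduce]) (auto intro!: eq_vecI)
  also have "\<dots> \<in> U"
  proof (rule e(2))
    \<comment> \<open>Close fractional parts mean that the difference is close to the difference of
      the floors, which is the integer supplied below.\<close>
    fix i assume "i < q"
    then have "\<bar>frac (L v (2 * p + q + i)) - frac (L w (2 * p + q + i))\<bar> < e"
      using vw(4)[of "2 * p + q + i"] by (simp add: f_def d_def)
    moreover have "frac (L v (2 * p + q + i)) - frac (L w (2 * p + q + i)) =
      L v (2 * p + q + i) - L w (2 * p + q + i) - real_of_int (\<lfloor>L v (2 * p + q + i)\<rfloor> - \<lfloor>L w (2 * p + q + i)\<rfloor>)"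
      by (simp add: frac_def)
    ultimately show "\<exists>k\<in>\<int>. \<bar>vec_index (vec q (\<lambda>i. L v (2 * p + q + i) - L w (2 * p + q + i))) i - k\<bar> < e"
      using \<open>i < q\<close>
      by (intro bexI[of _ "real_of_int (\<lfloor>L v (2 * p + q + i)\<rfloor> - \<lfloor>L w (2 * p + q + i)\<rfloor>)"]) simp_all
  qed (simp_all add: close)
  finally have "reduce (embed p q \<Phi> (v - w)) \<in> U \<inter> ?D"
    using car' unfolding lattice_pts_def by blast
  then have "reduce (embed p q \<Phi> (v - w)) = reduce (embed p q \<Phi> (0\<^sub>v (2 * p + q)))"
    unfolding U(2)[symmetric] embed0 by simp
  moreover have "inj_on (\<lambda>x. reduce (embed p q \<Phi> x)) (carrier_vec (2 * p + q))" using lat' by blast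
  ultimately have 0: "v - w = 0\<^sub>v (2 * p + q)"
    using car' by (auto dest: inj_onD)
  have "v = w"
  proof (rule eq_vecI)
    fix i assume i: "i < dim_vec w"
    then have "vec_index (v - w) i = 0" unfolding 0 using car by (simp add: d_def)
    then show "vec_index v i = vec_index w i" using i by simp
  qed (use car in simp)
  with vw(3) show False by simp
qed

section \<open>Theta series\<close>

lemma gaussian_summable_on_int:
  fixes c :: real
  assumes c: "c > 0"
  shows "(\<lambda>n::int. exp (- c * of_int n ^ 2)) summable_on UNIV"
proof -
  let ?f = "\<lambda>n::int. exp (- c * of_int n ^ 2)"
  have "summable (\<lambda>n. exp (- c) ^ n)"
    by (rule summable_geometric) (use c in simp)
  then have "summable (\<lambda>n::nat. norm (exp (- c * real n ^ 2)))"
  proof (rule summable_comparison_test'[where N=0])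
    fix n :: nat
    have "real n \<le> real n ^ 2"
      by (metis le_square of_nat_le_iff of_nat_mult power2_eq_square)
    then have "- c * real n ^ 2 \<le> - c * real n" using c by simp
    then show "norm (norm (exp (- c * real n ^ 2))) \<le> exp (- c) ^ n"
      by (simp add: mult.commute flip: exp_of_nat_mult)
  qed
  then have nat: "(\<lambda>n::nat. exp (- c * real n ^ 2)) summable_on UNIV"
    by (rule norm_summable_imp_summable_on)
  have "?f summable_on range int"
    using nat by (subst summable_on_reindex) (auto simp: o_def)
  moreover have "?f summable_on range (\<lambda>n. - int n)"
    using nat by (subst summable_on_reindex) (auto simp: o_def inj_on_def)
  \<comment> \<open>The two half-lines share 0, which must be counted once.\<close>
  then have "?f summable_on (range (\<lambda>n. - int n) - range int)"
    by (rule summable_on_subset_banach) auto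
  ultimately have "?f summable_on (range int \<union> (range (\<lambda>n. - int n) - range int))"
    by (rule summable_on_Un_disjoint) auto
  also have "range int \<union> (range (\<lambda>n. - int n) - range int) = UNIV"
    using int_cases2 by blast
  finally show ?thesis .
qed

text \<open>The factor that one integer coordinate contributes to f times the conjugate of its
  Heisenberg translate; the conjugation accounts for the minus sign before
  \<open>\<i>\<close>.\<close>

definition theta_term :: "real \<Rightarrow> int \<Rightarrow> int \<Rightarrow> complex" where
  "theta_term r m n = exp (of_real (- pi / 2 * (of_int n ^ 2 + of_int (n + m) ^ 2))
     - \<i> * of_real (2 * pi * r * of_int n + pi * of_int m * r))"

text \<open>Half of n^2 and a quarter of m^2 are split off from n^2 + (n + m)^2; the rest is a sum
  of squares. One factor makes the series in \<open>n\<close> converge and the other gives decay in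
  \<open>m\<close>, both uniformly in \<open>r\<close>.\<close>

lemma norm_theta_term_le:
  "norm (theta_term r m n) \<le> exp (- (pi / 8) * of_int m ^ 2) * exp (- (pi / 4) * of_int n ^ 2)"
proof -
  have "(of_int n ^ 2 + of_int (n + m) ^ 2 :: real) =
     of_int m ^ 2 / 4 + of_int n ^ 2 / 2 + (3 / 2 * (of_int n + 2 / 3 * of_int m) ^ 2 + of_int m ^ 2 / 12)"
    by (simp add: power2_eq_square field_simps)
  moreover have "0 \<le> 3 / 2 * (of_int n + 2 / 3 * of_int m) ^ 2 + (of_int m ^ 2 / 12 :: real)"
    by simp
  ultimately have "of_int m ^ 2 / 4 + of_int n ^ 2 / 2 \<le> (of_int n ^ 2 + of_int (n + m) ^ 2 :: real)"
    by linarith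
  then have "pi / 2 * (of_int m ^ 2 / 4 + of_int n ^ 2 / 2) \<le> pi / 2 * (of_int n ^ 2 + of_int (n + m) ^ 2 :: real)"
    by (intro mult_left_mono) auto
  then show ?thesis
    unfolding theta_term_def norm_exp_eq_Re exp_add[symmetric] by (simp add: algebra_simps)
qed

lemma theta_term_abs_summable: "(\<lambda>n. norm (theta_term r m n)) summable_on UNIV"
proof (rule Infinite_Sum.abs_summable_on_comparison_test')
  show "(\<lambda>n::int. exp (- (pi / 8) * of_int m ^ 2) * exp (- (pi / 4) * of_int n ^ 2)) summable_on UNIV"
    by (intro summable_on_cmult_right gaussian_summable_on_int) simp
qed (rule norm_theta_term_le)

text \<open>With \<tau> = i and z = -r + i m / 2 the theta exponent contains -pi (n^2 + n m), which
  the prefactor -pi m^2 / 2 completes to -pi (n^2 + (n + m)^2) / 2.\<close>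

lemma b_coeff_eq_infsum: "b_coeff r m = (\<Sum>\<^sub>\<infinity>n. theta_term r m n)"
  unfolding b_coeff_def theta_def infsum_cmult_right'[symmetric]
proof (rule infsum_cong)
  fix n :: int
  show "exp (- pi / 2 * of_int m ^ 2 - pi * \<i> * of_int m * of_real r) *
      exp (pi * \<i> * \<i> * of_int n ^ 2 + 2 * pi * \<i> * of_int n * (- of_real r + \<i> * of_int m / 2)) = theta_term r m n"
    unfolding theta_term_def exp_add[symmetric]
    by (rule arg_cong[where f=exp]) (simp add: complex_eq_iff power2_eq_square algebra_simps)
qed

lemma norm_b_coeff_le:
  obtains C where "C \<ge> 0" "\<And>r m. norm (b_coeff r m) \<le> C * exp (- (pi / 8) * of_int m ^ 2)"
proof
  define C where "C = (\<Sum>\<^sub>\<infinity>n::int. exp (- (pi / 4) * of_int n ^ 2))"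
  show "C \<ge> 0" unfolding C_def by (rule infsum_nonneg) simp
  fix r m
  have "norm (b_coeff r m) \<le> (\<Sum>\<^sub>\<infinity>n. norm (theta_term r m n))"
    unfolding b_coeff_eq_infsum by (rule norm_infsum_bound[OF theta_term_abs_summable])
  also have "\<dots> \<le> (\<Sum>\<^sub>\<infinity>n::int. exp (- (pi / 8) * of_int m ^ 2) * exp (- (pi / 4) * of_int n ^ 2))"
    by (intro infsum_mono theta_term_abs_summable norm_theta_term_le summable_on_cmult_right
        gaussian_summable_on_int) simp
  also have "\<dots> = C * exp (- (pi / 8) * of_int m ^ 2)"
    unfolding C_def by (simp add: infsum_cmult_right')
  finally show "norm (b_coeff r m) \<le> C * exp (- (pi / 8) * of_int m ^ 2)" .
qed

lemma infsum_theta_term_vec: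
  "(\<Sum>\<^sub>\<infinity>n\<in>carrier_vec q. \<Prod>j<q. theta_term (r j) (m j) (vec_index n j)) = (\<Prod>j<q. b_coeff (r j) (m j))"
proof -
  \<comment> \<open>Integer vectors are matched with extensional functions, the index set over which
    a product of absolutely convergent sums expands.\<close>
  have bij: "bij_betw (\<lambda>v. \<lambda>i\<in>{..<q}. vec_index v i) (carrier_vec q :: int vec set) (PiE {..<q} (\<lambda>_. UNIV))"
  proof (rule bij_betw_byWitness[where f'="vec q"])
    show "\<forall>v\<in>carrier_vec q. vec q (\<lambda>i\<in>{..<q}. vec_index v i) = (v :: int vec)"
    proof
      fix v :: "int vec" assume "v \<in> carrier_vec q"
      then show "vec q (\<lambda>i\<in>{..<q}. vec_index v i) = v" by (intro eq_vecI) simp_all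
    qed
    show "\<forall>n\<in>PiE {..<q} (\<lambda>_. UNIV :: int set). (\<lambda>i\<in>{..<q}. vec_index (vec q n) i) = n"
    proof
      fix n :: "nat \<Rightarrow> int" assume n: "n \<in> PiE {..<q} (\<lambda>_. UNIV)"
      show "(\<lambda>i\<in>{..<q}. vec_index (vec q n) i) = n"
      proof
        fix i show "(\<lambda>i\<in>{..<q}. vec_index (vec q n) i) i = n i"
          using PiE_arb[OF n, of i] by simp
      qed
    qed
    show "(\<lambda>v. \<lambda>i\<in>{..<q}. vec_index v i) ` (carrier_vec q :: int vec set) \<subseteq> PiE {..<q} (\<lambda>_. UNIV)"
      by (rule image_subsetI) (simp add: PiE_def Pi_def)
    show "vec q ` PiE {..<q} (\<lambda>_. UNIV) \<subseteq> (carrier_vec q :: int vec set)"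
      by (rule image_subsetI) simp
  qed
  have "(\<Prod>j<q. b_coeff (r j) (m j)) = (\<Sum>\<^sub>\<infinity>n\<in>PiE {..<q} (\<lambda>_. UNIV). \<Prod>j<q. theta_term (r j) (m j) (n j))"
    unfolding b_coeff_eq_infsum
    by (rule infsum_prod_PiE_abs[symmetric]) (auto simp: theta_term_abs_summable)
  also have "\<dots> = (\<Sum>\<^sub>\<infinity>n\<in>carrier_vec q. \<Prod>j<q. theta_term (r j) (m j) ((\<lambda>i\<in>{..<q}. vec_index n i) j))"
    by (rule infsum_reindex_bij_betw[OF bij, symmetric])
  finally show ?thesis by simp
qed

section \<open>The inner product of Gaussians\<close>

lemma posdef_mult_eq_0:
  assumes "posdef p A" "\<And>i. i < p \<Longrightarrow> (\<Sum>j<p. A i j * x j) = 0" "i < p"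
  shows "x i = 0"
proof (rule ccontr)
  assume "x i \<noteq> 0"
  then have "quad p A x > 0" using posdef_pos[OF assms(1,3)] by blast
  moreover have "quad p A x = (\<Sum>i<p. x i * (\<Sum>j<p. A i j * x j))"
    by (simp add: quad_def sum_distrib_left mult.assoc)
  then have "quad p A x = 0" using assms(2) by simp
  ultimately show False by simp
qed

lemma posdef_quad_nonneg:
  assumes "posdef p A"
  shows "quad p A s \<ge> 0"
proof -
  obtain c where c: "c > 0" "\<And>s. c * (\<Sum>i<p. (s i)^2) \<le> quad p A s"
    using posdef_coercive[OF assms] by blast
  show ?thesis by (rule order_trans[OF _ c(2)]) (use c(1) in \<open>simp add: sum_nonneg\<close>)
qed

lemma quad_add:
  assumes "\<And>i j. i < p \<Longrightarrow> j < p \<Longrightarrow> A i j = A j i"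
  shows "quad p A (\<lambda>i. s i + t i) = quad p A s + 2 * (\<Sum>i<p. s i * (\<Sum>j<p. A i j * t j)) + quad p A t"
proof -
  have "(\<Sum>i<p. \<Sum>j<p. t i * A i j * s j) = (\<Sum>j<p. \<Sum>i<p. t i * A i j * s j)" by (rule sum.swap)
  also have "\<dots> = (\<Sum>i<p. \<Sum>j<p. s i * A i j * t j)"
    by (intro sum.cong) (auto simp: assms)
  finally show ?thesis
    unfolding quad_def by (simp add: algebra_simps sum.distrib sum_distrib_left)
qed

lemma sum_double:
  fixes f :: "nat \<Rightarrow> 'a::comm_monoid_add"
  shows "(\<Sum>i<n. f i + f (n + i)) = (\<Sum>i<2 * n. f i)"
proof -
  have "(\<Sum>i<n + k. f i) = (\<Sum>i<n. f i) + (\<Sum>i<k. f (n + i))" for k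
    by (induction k) (simp_all add: add.assoc)
  then show ?thesis by (simp add: sum.distrib mult_2)
qed

section \<open>The imaginary part of Omega and the Hermitian form\<close>

locale theta_data =
  fixes p q :: nat and \<Omega> :: "complex mat"
  assumes even_q: "even q"
    and car: "\<Omega> \<in> carrier_mat p p"
    and sym: "transpose_mat \<Omega> = \<Omega>"
    and pd: "pos_def_mat p (map_mat Im \<Omega>)"
begin

definition Y :: "nat \<Rightarrow> nat \<Rightarrow> real" where "Y i j = Im (\<Omega> $$ (i, j))"

lemma Omega_sym: "i < p \<Longrightarrow> j < p \<Longrightarrow> \<Omega> $$ (i, j) = \<Omega> $$ (j, i)"
  using arg_cong[OF sym, of "\<lambda>A. A $$ (j, i)"] car by simp

lemma Y_mat: "map_mat Im \<Omega> = mat_of p Y"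
  using car by (intro eq_matI) (auto simp: Y_def)

lemma Y_posdef: "posdef p Y"
  unfolding posdef_def
proof (intro conjI allI impI)
  show "Y i j = Y j i" if "i < p" "j < p" for i j
    using Omega_sym[OF that] by (simp add: Y_def)
  fix s :: "nat \<Rightarrow> real" assume s: "\<exists>i<p. s i \<noteq> 0"
  then obtain i where i: "i < p" "s i \<noteq> 0" by blast
  have "vec p s \<noteq> 0\<^sub>v p"
  proof
    assume "vec p s = 0\<^sub>v p"
    then have "vec_index (vec p s) i = 0" using i(1) by simp
    then show False using i by simp
  qed
  then have "0 < scalar_prod (vec p s) (map_mat Im \<Omega> *\<^sub>v vec p s)"
    using pd unfolding pos_def_mat_def by simp
  also have "\<dots> = quad p Y s"
    using car by (simp add: scalar_prod_def quad_def Y_def atLeast0LessThan sum_distrib_left mult.assoc)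
  finally show "0 < quad p Y s" .
qed

definition Yinv :: "real mat" where "Yinv = the (mat_inverse (map_mat Im \<Omega>))"

text \<open>\<open>herm_form\<close> unwraps an optional inverse. Positive definiteness makes the
  determinant nonzero, so the option is not \<open>None\<close>.\<close>

lemma Yinv: "Yinv \<in> carrier_mat p p" "map_mat Im \<Omega> * Yinv = 1\<^sub>m p"
proof -
  have c: "map_mat Im \<Omega> \<in> carrier_mat p p" using car by simp
  have "Determinant.det (map_mat Im \<Omega>) \<noteq> 0"
    using posdef_det_pos[OF Y_posdef] by (simp add: Y_mat)
  then have "map_mat Im \<Omega> \<in> Units (ring_mat TYPE(real) p ())"
    by (rule det_non_zero_imp_unit[OF c])
  then obtain B where "mat_inverse (map_mat Im \<Omega>) = Some B"
    using mat_inverse(1)[OF c, where b="()"] by (cases "mat_inverse (map_mat Im \<Omega>)") auto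
  with mat_inverse(2)[OF c this] show "Yinv \<in> carrier_mat p p" "map_mat Im \<Omega> * Yinv = 1\<^sub>m p"
    by (auto simp: Yinv_def)
qed

text \<open>The vector V of the overview. Its half is the vector that
  \<open>gaussian_integral_multi\<close> requires for the matrix 2 Im Omega and the linear
  coefficient conj(w).\<close>

definition dual :: "(nat \<Rightarrow> complex) \<Rightarrow> nat \<Rightarrow> complex" where
  "dual w i = (\<Sum>j<p. of_real (Yinv $$ (i, j)) * cnj (w j))"

lemma dual_eq:
  assumes i: "i < p"
  shows "(\<Sum>j<p. of_real (Y i j) * dual w j) = cnj (w i)"
proof -
  have *: "(\<Sum>j<p. Y i j * Yinv $$ (j, k)) = (if i = k then 1 else 0)" if "k < p" for k
  proof -
    have "(map_mat Im \<Omega> * Yinv) $$ (i, k) = (\<Sum>j<p. Y i j * Yinv $$ (j, k))"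
      using car Yinv(1) i that by (simp add: scalar_prod_def Y_def atLeast0LessThan)
    then show ?thesis using i that unfolding Yinv(2) by simp
  qed
  have "(\<Sum>j<p. of_real (Y i j) * dual w j) = (\<Sum>j<p. \<Sum>k<p. of_real (Y i j * Yinv $$ (j, k)) * cnj (w k))"
    unfolding dual_def by (simp add: sum_distrib_left mult.assoc)
  also have "\<dots> = (\<Sum>k<p. \<Sum>j<p. of_real (Y i j * Yinv $$ (j, k)) * cnj (w k))" by (rule sum.swap)
  also have "\<dots> = (\<Sum>k<p. of_real (\<Sum>j<p. Y i j * Yinv $$ (j, k)) * cnj (w k))"
    by (simp add: sum_distrib_right)
  also have "\<dots> = (\<Sum>k<p. if i = k then cnj (w k) else 0)"
    by (rule sum.cong) (auto simp: *)
  finally show ?thesis using i by simp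
qed

text \<open>The underlined w for arbitrary real arguments: the coercivity argument evaluates it away
  from lattice points.\<close>

definition wvec :: "(nat \<Rightarrow> real) \<Rightarrow> (nat \<Rightarrow> real) \<Rightarrow> nat \<Rightarrow> complex" where
  "wvec a b i = (\<Sum>k<p. \<Omega> $$ (i, k) * of_real (a k)) + of_real (b i)"

text \<open>H(w, w) as the energy of V with respect to Im Omega, a form in which it is visibly real
  and nonnegative.\<close>

definition herm :: "(nat \<Rightarrow> complex) \<Rightarrow> real" where
  "herm w = quad p Y (\<lambda>i. Re (dual w i)) + quad p Y (\<lambda>i. Im (dual w i))"

text \<open>Substituting w = conj(Y V) turns the pairing of w with V into a Hermitian expression in
  V; its imaginary part cancels by exchanging indices, as \<open>Y\<close> is symmetric.\<close>

lemma herm_eq: "(\<Sum>i<p. w i * dual w i) = of_real (herm w)"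
proof -
  have "(\<Sum>i<p. w i * dual w i) = (\<Sum>i<p. cnj (\<Sum>j<p. of_real (Y i j) * dual w j) * dual w i)"
    by (intro sum.cong) (auto simp: dual_eq)
  also have "\<dots> = (\<Sum>i<p. \<Sum>j<p. of_real (Y i j) * (cnj (dual w j) * dual w i))"
    by (simp add: sum_distrib_right mult.assoc)
  finally have 1: "(\<Sum>i<p. w i * dual w i) = \<dots>" .
  have "Re (\<Sum>i<p. \<Sum>j<p. of_real (Y i j) * (cnj (dual w j) * dual w i)) = herm w"
    unfolding herm_def quad_def sum.distrib[symmetric] by (simp add: algebra_simps)
  moreover have "Im (\<Sum>i<p. \<Sum>j<p. of_real (Y i j) * (cnj (dual w j) * dual w i)) = 0"
  proof -
    have "(\<Sum>i<p. \<Sum>j<p. Y i j * (Re (dual w i) * Im (dual w j))) =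
       (\<Sum>j<p. \<Sum>i<p. Y i j * (Re (dual w i) * Im (dual w j)))" by (rule sum.swap)
    also have "\<dots> = (\<Sum>i<p. \<Sum>j<p. Y i j * (Re (dual w j) * Im (dual w i)))"
      by (intro sum.cong) (auto simp: posdef_sym[OF Y_posdef])
    finally show ?thesis by (simp add: algebra_simps sum.distrib sum_subtractf)
  qed
  ultimately show ?thesis unfolding 1 by (simp add: complex_eq_iff)
qed

lemma herm_form_eq:
  assumes "w1 \<in> carrier_vec p" "w2 \<in> carrier_vec p"
  shows "herm_form \<Omega> (underline_w \<Omega> (w1, w2, m, r)) (underline_w \<Omega> (w1, w2, m, r)) =
    of_real (herm (wvec (vec_index w1) (vec_index w2)))"
proof -
  let ?w = "wvec (vec_index w1) (vec_index w2)"
  have u: "underline_w \<Omega> (w1, w2, m, r) = vec p ?w"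
    using assms car unfolding underline_w_def
    by (intro eq_vecI) (auto simp: wvec_def scalar_prod_def atLeast0LessThan)
  have "map_mat complex_of_real Yinv *\<^sub>v map_vec cnj (vec p ?w) = vec p (dual ?w)"
    using Yinv(1) by (intro eq_vecI) (auto simp: dual_def scalar_prod_def atLeast0LessThan)
  then show ?thesis
    unfolding herm_form_def u Yinv_def[symmetric] herm_eq[symmetric]
    by (simp add: scalar_prod_def atLeast0LessThan)
qed

lemma herm_nonneg: "herm w \<ge> 0"
  unfolding herm_def by (intro add_nonneg_nonneg posdef_quad_nonneg Y_posdef)

text \<open>Vanishing energy gives V = 0 and hence w = 0. As \<open>a\<close> and \<open>b\<close>
  are real, the imaginary part of w is Y a, which forces a = 0; then w reduces to b.\<close>

lemma herm_eq_0:
  assumes "herm (wvec a b) = 0" "i < p"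
  shows "a i = 0 \<and> b i = 0"
proof -
  let ?w = "wvec a b"
  have "quad p Y (\<lambda>i. Re (dual ?w i)) = 0" "quad p Y (\<lambda>i. Im (dual ?w i)) = 0"
    using assms(1) posdef_quad_nonneg[OF Y_posdef, of "\<lambda>i. Re (dual ?w i)"]
      posdef_quad_nonneg[OF Y_posdef, of "\<lambda>i. Im (dual ?w i)"]
    unfolding herm_def by linarith+
  then have "dual ?w i = 0" if "i < p" for i
    using posdef_pos[OF Y_posdef that, of "\<lambda>i. Re (dual ?w i)"] posdef_pos[OF Y_posdef that, of "\<lambda>i. Im (dual ?w i)"]
    by (auto simp: complex_eq_iff)
  then have w: "?w i = 0" if "i < p" for i
    using dual_eq[OF that, of ?w] by simp
  have "(\<Sum>k<p. Y i k * a k) = Im (?w i)" for i by (simp add: wvec_def Y_def)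
  then have a: "a i = 0" if "i < p" for i
    using posdef_mult_eq_0[OF Y_posdef, of a] w that by simp
  then show ?thesis using w[OF assms(2)] assms(2) by (simp add: wvec_def)
qed

section \<open>Evaluation of the inner product\<close>

text \<open>Evenness of \<open>q\<close> enters here: the pairs (i, q/2 + i) run through all
  indices, so the lattice Gaussian is a product over single coordinates.\<close>

lemma gauss_fun_eq:
  "gauss_fun p q \<Omega> s n = exp (pi * \<i> * quad p (\<lambda>i j. \<Omega> $$ (i, j)) (\<lambda>i. of_real (vec_index s i))
     + of_real (- pi / 2 * (\<Sum>i<q. of_int (vec_index n i) ^ 2)))"
proof -
  have "(\<Sum>i<q div 2. of_int (vec_index n i) ^ 2 + of_int (vec_index n (q div 2 + i)) ^ 2) =
      (\<Sum>i<q. of_int (vec_index n i) ^ 2 :: complex)"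
    unfolding sum_double[of "\<lambda>i. of_int (vec_index n i) ^ 2" "q div 2"] using even_q by simp
  then show ?thesis unfolding gauss_fun_def quad_def by simp
qed

text \<open>Omega - conj(Omega) = 2 i Y yields the real quadratic part. The cross term of the
  shifted form, together with \<open>b\<close>, yields conj(Omega) a + b = conj(w), and the terms
  free of \<open>s\<close> combine in the same way.\<close>

lemma phase_exponent:
  fixes s a b :: "nat \<Rightarrow> real"
  shows "pi * \<i> * quad p (\<lambda>i j. \<Omega> $$ (i, j)) (\<lambda>i. of_real (s i))
     - pi * \<i> * quad p (\<lambda>i j. cnj (\<Omega> $$ (i, j))) (\<lambda>i. of_real (s i) + of_real (a i))
     - 2 * pi * \<i> * (\<Sum>i<p. of_real (b i) * of_real (s i)) - pi * \<i> * (\<Sum>i<p. of_real (a i) * of_real (b i)) =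
   - of_real (pi * quad p (\<lambda>i j. 2 * Y i j) s)
     - 2 * of_real pi * \<i> * (\<Sum>i<p. of_real (s i) * cnj (wvec a b i))
     - of_real pi * \<i> * (\<Sum>i<p. of_real (a i) * cnj (wvec a b i))"
proof -
  let ?C = "\<lambda>i j. cnj (\<Omega> $$ (i, j))"
  have 1: "quad p ?C (\<lambda>i. of_real (s i) + of_real (a i)) = quad p ?C (\<lambda>i. of_real (s i))
     + 2 * (\<Sum>i<p. of_real (s i) * (\<Sum>j<p. ?C i j * of_real (a j))) + quad p ?C (\<lambda>i. of_real (a i))"
    by (rule quad_add) (simp add: Omega_sym)
  have cY: "cnj (\<Omega> $$ (i, j)) = \<Omega> $$ (i, j) - 2 * \<i> * of_real (Y i j)" for i j
    by (simp add: complex_eq_iff Y_def)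
  have 2: "quad p ?C (\<lambda>i. of_real (s i)) = quad p (\<lambda>i j. \<Omega> $$ (i, j)) (\<lambda>i. of_real (s i)) - \<i> * of_real (quad p (\<lambda>i j. 2 * Y i j) s)"
    unfolding quad_def cY by (simp add: algebra_simps sum_subtractf sum_distrib_left)
  have w: "(\<Sum>j<p. ?C i j * of_real (a j)) = cnj (wvec a b i) - of_real (b i)" for i
    by (simp add: wvec_def)
  have 3: "quad p ?C (\<lambda>i. of_real (a i)) = (\<Sum>i<p. of_real (a i) * (\<Sum>j<p. ?C i j * of_real (a j)))"
    unfolding quad_def by (simp add: sum_distrib_left mult.assoc)
  have 4: "(\<Sum>i<p. x i * (cnj (wvec a b i) - of_real (b i))) = (\<Sum>i<p. x i * cnj (wvec a b i)) - (\<Sum>i<p. x i * of_real (b i))"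
    for x :: "nat \<Rightarrow> complex"
    by (simp add: algebra_simps sum_subtractf)
  have 5: "(\<Sum>i<p. complex_of_real (b i) * of_real (s i)) = (\<Sum>i<p. of_real (s i) * of_real (b i))"
    by (simp add: mult.commute)
  show ?thesis unfolding 1 2 3 w 4 5 by (simp add: algebra_simps)
qed

text \<open>The Gaussian integral contributes half the pairing of conj(w) with V. Replacing conj(w)
  by w there costs 2 i (Y a) paired with V, which by symmetry of \<open>Y\<close> is 2 i times the
  pairing of \<open>a\<close> with conj(w): exactly the constant term on the left.\<close>

lemma completed_exponent:
  fixes a b :: "nat \<Rightarrow> real"
  defines "w \<equiv> wvec a b"
  shows "- of_real pi * \<i> * (\<Sum>i<p. of_real (a i) * cnj (w i))
      - of_real pi * quad p (\<lambda>i j. of_real (2 * Y i j)) (\<lambda>j. dual w j / 2) = - (of_real pi / 2) * of_real (herm w)"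
proof -
  have "quad p (\<lambda>i j. of_real (2 * Y i j)) (\<lambda>j. dual w j / 2) = (\<Sum>i<p. dual w i * (\<Sum>j<p. of_real (Y i j) * dual w j)) / 2"
    unfolding quad_def by (simp add: sum_distrib_left sum_divide_distrib algebra_simps)
  also have "\<dots> = (\<Sum>i<p. cnj (w i) * dual w i) / 2"
    by (simp add: dual_eq mult.commute[of "dual w _"])
  finally have 1: "quad p (\<lambda>i j. of_real (2 * Y i j)) (\<lambda>j. dual w j / 2) = \<dots>" .
  have "(\<Sum>i<p. (w i - cnj (w i)) * dual w i) = (\<Sum>i<p. 2 * \<i> * (\<Sum>k<p. of_real (Y i k) * of_real (a k)) * dual w i)"
    by (intro sum.cong) (auto simp: w_def wvec_def Y_def complex_eq_iff sum_negf)
  also have "\<dots> = (\<Sum>i<p. \<Sum>k<p. 2 * \<i> * of_real (Y i k) * of_real (a k) * dual w i)"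
    by (simp add: sum_distrib_left sum_distrib_right mult.assoc)
  also have "\<dots> = (\<Sum>k<p. \<Sum>i<p. 2 * \<i> * of_real (Y i k) * of_real (a k) * dual w i)" by (rule sum.swap)
  also have "\<dots> = (\<Sum>k<p. 2 * \<i> * of_real (a k) * (\<Sum>i<p. of_real (Y k i) * dual w i))"
    unfolding sum_distrib_left by (intro sum.cong) (auto simp: posdef_sym[OF Y_posdef])
  also have "\<dots> = 2 * \<i> * (\<Sum>k<p. of_real (a k) * cnj (w k))"
    by (simp add: dual_eq sum_distrib_left mult.assoc)
  finally have 2: "(\<Sum>i<p. w i * dual w i) = (\<Sum>i<p. cnj (w i) * dual w i) + 2 * \<i> * (\<Sum>k<p. of_real (a k) * cnj (w k))"
    by (simp add: algebra_simps sum_subtractf)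
  show ?thesis unfolding 1 herm_eq[symmetric] 2 by (simp add: field_simps)
qed

text \<open>The variables separate: the Gaussian is a product of a function of \<open>s\<close> and
  one of \<open>n\<close>, and the Heisenberg phase is additive in the two. Hence the integral over
  \<open>s\<close> is the same for every \<open>n\<close>.\<close>

lemma integrand_eq:
  assumes "w1 \<in> carrier_vec p" "w2 \<in> carrier_vec p" "m \<in> carrier_vec q" "r \<in> carrier_vec q" "n \<in> carrier_vec q"
  defines "w \<equiv> wvec (vec_index w1) (vec_index w2)"
  shows "gauss_fun p q \<Omega> (vec p s) n * cnj (heisenberg (w1, w2, m, r) (gauss_fun p q \<Omega>) (vec p s) n) =
    exp (- of_real (pi * quad p (\<lambda>i j. 2 * Y i j) s) - 2 * of_real pi * \<i> * (\<Sum>i<p. of_real (s i) * cnj (w i)))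
    * (exp (- of_real pi * \<i> * (\<Sum>i<p. of_real (vec_index w1 i) * cnj (w i)))
    * (\<Prod>j<q. theta_term (vec_index r j) (vec_index m j) (vec_index n j)))"
proof -
  let ?Q = "quad p (\<lambda>i j. \<Omega> $$ (i, j)) (\<lambda>i. of_real (s i))"
  let ?C = "quad p (\<lambda>i j. cnj (\<Omega> $$ (i, j))) (\<lambda>i. of_real (s i) + of_real (vec_index w1 i))"
  let ?N = "\<lambda>n. \<Sum>i<q. (of_int (vec_index n i) :: real) ^ 2"
  have g: "gauss_fun p q \<Omega> (vec p s) n = exp (pi * \<i> * ?Q + of_real (- pi / 2 * ?N n))"
    unfolding gauss_fun_eq by (simp add: quad_def)
  have cg: "cnj (gauss_fun p q \<Omega> (vec p s + w1) (n + m)) = exp (- (pi * \<i> * ?C) + of_real (- pi / 2 * ?N (n + m)))"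
    unfolding gauss_fun_eq exp_cnj using assms by (simp add: quad_def)
  have N: "?N (n + m) = (\<Sum>i<q. of_int (vec_index n i + vec_index m i) ^ 2)"
    using assms by simp
  have sp: "scalar_prod w2 (vec p s) = (\<Sum>i<p. vec_index w2 i * s i)"
    "scalar_prod r (map_vec real_of_int n) = (\<Sum>i<q. vec_index r i * of_int (vec_index n i))"
    "scalar_prod w1 w2 = (\<Sum>i<p. vec_index w1 i * vec_index w2 i)"
    "scalar_prod (map_vec real_of_int m) r = (\<Sum>i<q. of_int (vec_index m i) * vec_index r i)"
    using assms by (simp_all add: scalar_prod_def atLeast0LessThan)
  have th: "(\<Prod>j<q. theta_term (vec_index r j) (vec_index m j) (vec_index n j)) =
     exp (of_real (- pi / 2 * ?N n) + of_real (- pi / 2 * ?N (n + m))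
       - \<i> * (2 * pi * of_real (scalar_prod r (map_vec real_of_int n)) + pi * of_real (scalar_prod (map_vec real_of_int m) r)))"
    unfolding theta_term_def exp_sum[OF finite_lessThan, symmetric] N sp
    by (rule arg_cong[where f=exp])
       (simp add: sum_distrib_left sum_distrib_right algebra_simps sum.distrib sum_subtractf sum_negf)
  have "gauss_fun p q \<Omega> (vec p s) n * cnj (heisenberg (w1, w2, m, r) (gauss_fun p q \<Omega>) (vec p s) n) =
    exp (pi * \<i> * ?Q - pi * \<i> * ?C - 2 * pi * \<i> * (\<Sum>i<p. of_real (vec_index w2 i) * of_real (s i))
       - pi * \<i> * (\<Sum>i<p. of_real (vec_index w1 i) * of_real (vec_index w2 i)))
    * (\<Prod>j<q. theta_term (vec_index r j) (vec_index m j) (vec_index n j))"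
    unfolding heisenberg_def prod.case complex_cnj_mult cg g th exp_cnj exp_add[symmetric] sp(1,3)
    by (rule arg_cong[where f=exp]) (simp add: algebra_simps)
  then show ?thesis
    unfolding phase_exponent w_def by (simp only: exp_diff exp_minus divide_inverse mult.assoc mult_minus_left)
qed

lemma L2_inner_gauss:
  assumes c: "w1 \<in> carrier_vec p" "w2 \<in> carrier_vec p" "m \<in> carrier_vec q" "r \<in> carrier_vec q"
  defines "h \<equiv> (w1, w2, m, r)"
  shows "L2_inner p q (gauss_fun p q \<Omega>) (heisenberg h (gauss_fun p q \<Omega>)) =
    of_real (1 / sqrt (2 ^ p * Determinant.det (map_mat Im \<Omega>)))
    * (b_tilde q h * exp (- (pi / 2) * herm_form \<Omega> (underline_w \<Omega> h) (underline_w \<Omega> h)))"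
proof -
  define w where "w = wvec (vec_index w1) (vec_index w2)"
  let ?A = "\<lambda>i j. 2 * Y i j"
  have A: "posdef p ?A"
  proof -
    have "quad p ?A s = 2 * quad p Y s" for s
      unfolding quad_def by (simp add: sum_distrib_left algebra_simps)
    then show ?thesis using Y_posdef unfolding posdef_def by simp
  qed
  have det: "Determinant.det (mat_of p ?A) = 2 ^ p * Determinant.det (map_mat Im \<Omega>)"
  proof -
    have "mat_of p ?A = 2 \<cdot>\<^sub>m map_mat Im \<Omega>" unfolding Y_mat by (intro eq_matI) auto
    then show ?thesis using car by simp
  qed
  have u: "(\<Sum>j<p. of_real (?A i j) * (dual w j / 2)) = cnj (w i)" if "i < p" for i
    using dual_eq[OF that, of w] by simp
  have I: "(LINT s|PiM {..<p} (\<lambda>_. lborel).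
      exp (- of_real (pi * quad p ?A s) - 2 * of_real pi * \<i> * (\<Sum>i<p. of_real (s i) * cnj (w i))))
    = exp (- of_real pi * quad p (\<lambda>i j. of_real (?A i j)) (\<lambda>j. dual w j / 2))
       / of_real (sqrt (2 ^ p * Determinant.det (map_mat Im \<Omega>)))"
  proof -
    have "(\<Sum>i<p. of_real (s i) * cnj (w i)) = (\<Sum>i<p. of_real (s i) * (\<Sum>j<p. of_real (?A i j) * (dual w j / 2)))"
      for s :: "nat \<Rightarrow> real"
      by (intro sum.cong refl) (simp only: u lessThan_iff)
    then show ?thesis using gaussian_integral_multi[OF A, of "\<lambda>j. dual w j / 2"] unfolding det by simp
  qed
  let ?K = "exp (- of_real pi * \<i> * (\<Sum>i<p. of_real (vec_index w1 i) * cnj (w i)))"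
  have "L2_inner p q (gauss_fun p q \<Omega>) (heisenberg h (gauss_fun p q \<Omega>)) =
    (\<Sum>\<^sub>\<infinity>n\<in>carrier_vec q. (LINT s|PiM {..<p} (\<lambda>_. lborel).
      exp (- of_real (pi * quad p ?A s) - 2 * of_real pi * \<i> * (\<Sum>i<p. of_real (s i) * cnj (w i)))
      * (?K * (\<Prod>j<q. theta_term (vec_index r j) (vec_index m j) (vec_index n j)))))"
    unfolding L2_inner_def h_def w_def
    by (intro infsum_cong Bochner_Integration.integral_cong refl integrand_eq c)
  also have "\<dots> = (\<Sum>\<^sub>\<infinity>n\<in>carrier_vec q. exp (- of_real pi * quad p (\<lambda>i j. of_real (?A i j)) (\<lambda>j. dual w j / 2))
       / of_real (sqrt (2 ^ p * Determinant.det (map_mat Im \<Omega>))) * ?K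
       * (\<Prod>j<q. theta_term (vec_index r j) (vec_index m j) (vec_index n j)))"
    unfolding integral_mult_left_zero I by (simp only: mult.assoc)
  also have "\<dots> = exp (- of_real pi * quad p (\<lambda>i j. of_real (?A i j)) (\<lambda>j. dual w j / 2))
       / of_real (sqrt (2 ^ p * Determinant.det (map_mat Im \<Omega>))) * ?K * b_tilde q h"
    unfolding infsum_cmult_right' infsum_theta_term_vec by (simp add: b_tilde_def h_def)
  also have "\<dots> = of_real (1 / sqrt (2 ^ p * Determinant.det (map_mat Im \<Omega>))) * (b_tilde q h *
      exp (- of_real pi * \<i> * (\<Sum>i<p. of_real (vec_index w1 i) * cnj (w i))
        - of_real pi * quad p (\<lambda>i j. of_real (?A i j)) (\<lambda>j. dual w j / 2)))"
    by (simp add: exp_diff exp_minus field_simps)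
  also have "- of_real pi * \<i> * (\<Sum>i<p. of_real (vec_index w1 i) * cnj (w i))
        - of_real pi * quad p (\<lambda>i j. of_real (?A i j)) (\<lambda>j. dual w j / 2) =
      - (pi / 2) * herm_form \<Omega> (underline_w \<Omega> h) (underline_w \<Omega> h)"
    unfolding h_def herm_form_eq[OF c(1,2)] w_def completed_exponent by simp
  finally show ?thesis .
qed

end

section \<open>Decay of the coefficients\<close>

text \<open>The exponential series at c (1 + T) has nonnegative terms and so dominates its
  \<open>N\<close>-th one.\<close>

lemma poly_exp_bounded:
  fixes c T :: real
  assumes c: "c > 0" and T: "T \<ge> 0"
  shows "(1 + T) ^ N * exp (- (c * T)) \<le> exp c * fact N / c ^ N"
proof -
  have "sum (\<lambda>n. (c * (1 + T)) ^ n /\<^sub>R fact n) {N} \<le> exp (c * (1 + T))"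
    unfolding exp_def by (intro sum_le_suminf summable_exp_generic) (use c T in auto)
  then have "(c * (1 + T)) ^ N / fact N \<le> exp (c * (1 + T))"
    by (simp add: divide_inverse_commute)
  then have "c ^ N * (1 + T) ^ N \<le> exp (c * (1 + T)) * fact N"
    unfolding power_mult_distrib by (simp only: pos_divide_le_eq[OF fact_gt_zero])
  then have "(1 + T) ^ N \<le> exp (c * (1 + T)) * fact N / c ^ N"
    using c by (simp add: pos_le_divide_eq mult.commute)
  then have "(1 + T) ^ N \<le> exp (c + c * T) * fact N / c ^ N"
    by (simp only: distrib_left mult_1_right)
  then have "(1 + T) ^ N * exp (- (c * T)) \<le> exp (c + c * T) * fact N / c ^ N * exp (- (c * T))"
    by (rule mult_right_mono) simp
  also have "\<dots> = exp c * fact N / c ^ N"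
    by (simp add: exp_add exp_minus)
  finally show ?thesis .
qed

text \<open>Rapid decay is measured by sums of absolute values, whereas the energy controls squares;
  on integer vectors the latter dominate.\<close>

lemma abs_of_int_le_square: "\<bar>real_of_int k\<bar> \<le> real_of_int k ^ 2"
proof -
  have "\<bar>k\<bar> \<le> k ^ 2"
  proof (cases "k = 0")
    case False
    then have "\<bar>k\<bar> * 1 \<le> \<bar>k\<bar> * \<bar>k\<bar>" by (intro mult_left_mono) auto
    then show ?thesis by (simp add: power2_eq_square)
  qed simp
  then have "real_of_int \<bar>k\<bar> \<le> real_of_int (k ^ 2)" by (simp only: of_int_le_iff)
  then show ?thesis by simp
qed

context theta_data
begin

lemma herm_cong: "(\<And>i. i < p \<Longrightarrow> w i = w' i) \<Longrightarrow> herm w = herm w'"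
proof -
  assume "\<And>i. i < p \<Longrightarrow> w i = w' i"
  then have "dual w = dual w'" unfolding dual_def by (intro ext sum.cong) auto
  then show ?thesis by (simp add: herm_def)
qed

lemma herm_wvec_scale: "herm (wvec (\<lambda>i. t * a i) (\<lambda>i. t * b i)) = t\<^sup>2 * herm (wvec a b)"
proof -
  have "wvec (\<lambda>i. t * a i) (\<lambda>i. t * b i) = (\<lambda>i. of_real t * wvec a b i)"
    by (rule ext) (simp add: wvec_def sum_distrib_left algebra_simps)
  moreover have "dual (\<lambda>i. of_real t * wvec a b i) = (\<lambda>i. of_real t * dual (wvec a b) i)"
    by (rule ext) (simp add: dual_def sum_distrib_left algebra_simps)
  ultimately show ?thesis by (simp add: herm_def quad_scale distrib_left)
qed

text \<open>Zero energy annihilates the first 2 p + q rows at a real vector, so the vector vanishes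
  by \<open>lattice_embedding_kernel_trivial\<close>.\<close>

lemma lattice_energy_coercive:
  assumes lat: "lattice_embedding p q \<Phi>"
  defines "L \<equiv> lin (2 * p + q) \<Phi>"
  shows "\<exists>c>0. \<forall>x. c * (\<Sum>i<2 * p + q. (x i)\<^sup>2) \<le>
    herm (wvec (L x) (\<lambda>i. L x (p + i))) + (\<Sum>i<q. (L x (2 * p + i))\<^sup>2)"
proof (rule quadratic_coercive)
  show "continuous_on UNIV (\<lambda>x. herm (wvec (L x) (\<lambda>i. L x (p + i))) + (\<Sum>i<q. (L x (2 * p + i))\<^sup>2))"
    unfolding herm_def quad_def dual_def wvec_def L_def lin_def
    by (intro continuous_intros continuous_on_product_coordinates)
next
  fix t :: real and x
  have "L (\<lambda>i. t * x i) = (\<lambda>i. t * L x i)" unfolding L_def by (rule ext) (rule lin_scale)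
  then show "herm (wvec (L (\<lambda>i. t * x i)) (\<lambda>i. L (\<lambda>i. t * x i) (p + i))) + (\<Sum>i<q. (L (\<lambda>i. t * x i) (2 * p + i))\<^sup>2) =
      t\<^sup>2 * (herm (wvec (L x) (\<lambda>i. L x (p + i))) + (\<Sum>i<q. (L x (2 * p + i))\<^sup>2))"
    by (simp add: herm_wvec_scale power_mult_distrib sum_distrib_left distrib_left)
next
  fix x :: "nat \<Rightarrow> real" assume x: "\<exists>i<2 * p + q. x i \<noteq> 0"
  let ?H = "herm (wvec (L x) (\<lambda>i. L x (p + i)))" and ?M = "\<Sum>i<q. (L x (2 * p + i))\<^sup>2"
  have nn: "?H \<ge> 0" "?M \<ge> 0" by (rule herm_nonneg) (simp add: sum_nonneg)
  show "0 < ?H + ?M"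
  proof (rule ccontr)
    assume "\<not> 0 < ?H + ?M"
    then have 0: "?H = 0" "?M = 0" using nn by auto
    have "L x i = 0" if "i < 2 * p + q" for i
    proof -
      consider "i < p" | "p \<le> i" "i < 2 * p" | "2 * p \<le> i" by linarith
      then show ?thesis
      proof cases
        case 1
        then show ?thesis using herm_eq_0[OF 0(1)] by blast
      next
        case 2
        then show ?thesis using herm_eq_0[OF 0(1), of "i - p"] by simp
      next
        case 3
        have "\<forall>i\<in>{..<q}. (L x (2 * p + i))\<^sup>2 = 0"
          using 0(2) by (subst (asm) sum_nonneg_eq_0_iff) auto
        then show ?thesis using 3 that by (auto dest!: bspec[where x="i - 2 * p"])
      qed
    qed
    with x lattice_embedding_kernel_trivial[OF lat] show False unfolding L_def by blast
  qed
next
  fix x y :: "nat \<Rightarrow> real" assume "\<And>i. i < 2 * p + q \<Longrightarrow> x i = y i"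
  then have "L x = L y" unfolding L_def lin_def by (intro ext sum.cong) auto
  then show "herm (wvec (L x) (\<lambda>i. L x (p + i))) + (\<Sum>i<q. (L x (2 * p + i))\<^sup>2) =
     herm (wvec (L y) (\<lambda>i. L y (p + i))) + (\<Sum>i<q. (L y (2 * p + i))\<^sup>2)" by simp
qed

definition coeff :: "point \<Rightarrow> complex" where
  "coeff h = b_tilde q h * exp (- (pi / 2) * herm_form \<Omega> (underline_w \<Omega> h) (underline_w \<Omega> h))"

lemma norm_coeff_le:
  obtains C where "C \<ge> 0" "\<And>w1 w2 m r. w1 \<in> carrier_vec p \<Longrightarrow> w2 \<in> carrier_vec p \<Longrightarrow>
    norm (coeff (w1, w2, m, r)) \<le>
      C * exp (- (pi / 8) * (herm (wvec (vec_index w1) (vec_index w2)) + (\<Sum>i<q. real_of_int (vec_index m i) ^ 2)))"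
proof -
  obtain C where C: "C \<ge> 0" "\<And>r m. norm (b_coeff r m) \<le> C * exp (- (pi / 8) * of_int m ^ 2)"
    by (rule norm_b_coeff_le) blast
  show ?thesis
  proof (rule that[of "C ^ q"])
    fix w1 w2 :: "real vec" and m :: "int vec" and r :: "real vec"
    assume w: "w1 \<in> carrier_vec p" "w2 \<in> carrier_vec p"
    let ?h = "herm (wvec (vec_index w1) (vec_index w2))"
    have "norm (b_tilde q (w1, w2, m, r)) \<le> (\<Prod>j<q. C * exp (- (pi / 8) * of_int (vec_index m j) ^ 2))"
      unfolding b_tilde_def prod.case prod_norm[symmetric] by (intro prod_mono conjI norm_ge_zero C(2))
    also have "\<dots> = C ^ q * exp (- (pi / 8) * (\<Sum>i<q. real_of_int (vec_index m i) ^ 2))"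
      by (simp add: prod.distrib exp_sum[symmetric] sum_distrib_left)
    finally have 1: "norm (b_tilde q (w1, w2, m, r)) \<le> \<dots>" .
    have "norm (exp (- (pi / 2) * herm_form \<Omega> (underline_w \<Omega> (w1, w2, m, r)) (underline_w \<Omega> (w1, w2, m, r)))) = exp (- (pi / 2) * ?h)"
      unfolding herm_form_eq[OF w] by (simp add: norm_exp_eq_Re)
    \<comment> \<open>Weakened from pi / 2 to the constant of the bound on \<open>b_coeff\<close>,
      so that both exponents join into one multiple of the energy.\<close>
    also have "\<dots> \<le> exp (- (pi / 8) * ?h)"
      using herm_nonneg by simp
    finally have "norm (coeff (w1, w2, m, r)) \<le>
      (C ^ q * exp (- (pi / 8) * (\<Sum>i<q. real_of_int (vec_index m i) ^ 2))) * exp (- (pi / 8) * ?h)"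
      unfolding coeff_def norm_mult using 1 by (intro mult_mono) (auto simp: C)
    also have "\<dots> = C ^ q * exp (- (pi / 8) * (?h + (\<Sum>i<q. real_of_int (vec_index m i) ^ 2)))"
      by (simp add: algebra_simps exp_add[symmetric])
    finally show "norm (coeff (w1, w2, m, r)) \<le> \<dots>" .
  qed (simp add: C)
qed

text \<open>Stated for any \<open>a\<close> agreeing with \<open>coeff\<close> on the lattice,
  because the theta function vanishes elsewhere while \<open>coeff\<close> is given by its formula
  everywhere.\<close>

lemma coeff_decreasing:
  assumes lat: "lattice_embedding p q \<Phi>"
    and a: "\<And>h. h \<in> lattice_pts p q \<Phi> \<Longrightarrow> a h = coeff h"
  shows "rapidly_decreasing p q \<Phi> a"
  unfolding rapidly_decreasing_def
proof
  fix N
  have \<Phi>: "\<Phi> \<in> carrier_mat (2 * p + 2 * q) (2 * p + q)"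
    using lat unfolding lattice_embedding_def by blast
  define L where "L = lin (2 * p + q) \<Phi>"
  obtain c where c: "c > 0" "\<And>x. c * (\<Sum>i<2 * p + q. (x i)\<^sup>2) \<le>
      herm (wvec (L x) (\<lambda>i. L x (p + i))) + (\<Sum>i<q. (L x (2 * p + i))\<^sup>2)"
    using lattice_energy_coercive[OF lat] unfolding L_def by blast
  obtain C where C: "C \<ge> 0" "\<And>w1 w2 m r. w1 \<in> carrier_vec p \<Longrightarrow> w2 \<in> carrier_vec p \<Longrightarrow>
    norm (coeff (w1, w2, m, r)) \<le>
      C * exp (- (pi / 8) * (herm (wvec (vec_index w1) (vec_index w2)) + (\<Sum>i<q. real_of_int (vec_index m i) ^ 2)))"
    by (rule norm_coeff_le) blast
  define k where "k = pi / 8 * c"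
  have k: "k > 0" using c by (simp add: k_def)
  have "(1 + (\<Sum>i<2 * p + q. \<bar>real_of_int (vec_index x i)\<bar>)) ^ N * cmod (a (embed p q \<Phi> x)) \<le> C * (exp k * fact N / k ^ N)"
    if x: "x \<in> carrier_vec (2 * p + q)" for x
  proof -
    define y where "y = (\<lambda>j. real_of_int (vec_index x j))"
    define T where "T = (\<Sum>i<2 * p + q. \<bar>y i\<bar>)"
    have T: "T \<ge> 0" unfolding T_def by (rule sum_nonneg) simp
    define w1 where "w1 = vec p (L y)"
    define w2 where "w2 = vec p (\<lambda>i. L y (p + i))"
    define m where "m = vec q (\<lambda>i. \<lfloor>L y (2 * p + i)\<rfloor>)"
    define r where "r = vec q (\<lambda>i. L y (2 * p + q + i))"
    have e: "embed p q \<Phi> x = (w1, w2, m, r)"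
      unfolding embed_lin[OF \<Phi> x] Let_def w1_def w2_def m_def r_def L_def y_def ..
    have w: "herm (wvec (vec_index w1) (vec_index w2)) = herm (wvec (L y) (\<lambda>i. L y (p + i)))"
      by (rule herm_cong) (simp add: wvec_def w1_def w2_def)
    \<comment> \<open>The floor in \<open>embed\<close> changes nothing here, as integral rows take
      integer values on integer vectors.\<close>
    have m: "real_of_int (vec_index m i) = L y (2 * p + i)" if "i < q" for i
    proof -
      have "L y (2 * p + i) \<in> \<int>"
        unfolding L_def by (rule lin_integer_row[OF lat]) (use that in \<open>auto simp: y_def\<close>)
      then show ?thesis using that by (simp add: m_def)
    qed
    have "T \<le> (\<Sum>i<2 * p + q. (y i)\<^sup>2)"
      unfolding T_def y_def by (intro sum_mono abs_of_int_le_square)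
    then have "c * T \<le> c * (\<Sum>i<2 * p + q. (y i)\<^sup>2)" using c(1) by simp
    also have "\<dots> \<le> herm (wvec (vec_index w1) (vec_index w2)) + (\<Sum>i<q. real_of_int (vec_index m i) ^ 2)"
      using c(2)[of y] unfolding w by (simp add: m)
    finally have "exp (- (pi / 8) * (herm (wvec (vec_index w1) (vec_index w2)) + (\<Sum>i<q. real_of_int (vec_index m i) ^ 2)))
       \<le> exp (- (k * T))"
      by (simp add: k_def)
    then have "C * exp (- (pi / 8) * (herm (wvec (vec_index w1) (vec_index w2)) + (\<Sum>i<q. real_of_int (vec_index m i) ^ 2)))
       \<le> C * exp (- (k * T))"
      using C(1) by (rule mult_left_mono)
    moreover have "cmod (coeff (w1, w2, m, r)) \<le>
       C * exp (- (pi / 8) * (herm (wvec (vec_index w1) (vec_index w2)) + (\<Sum>i<q. real_of_int (vec_index m i) ^ 2)))"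
      by (rule C(2)) (simp_all add: w1_def w2_def)
    ultimately have "cmod (coeff (w1, w2, m, r)) \<le> C * exp (- (k * T))" by linarith
    moreover have "a (embed p q \<Phi> x) = coeff (w1, w2, m, r)"
      unfolding e[symmetric] by (rule a) (use x in \<open>simp add: lattice_pts_def\<close>)
    ultimately have "(1 + T) ^ N * cmod (a (embed p q \<Phi> x)) \<le> (1 + T) ^ N * (C * exp (- (k * T)))"
      using T by (intro mult_left_mono) auto
    also have "\<dots> = C * ((1 + T) ^ N * exp (- (k * T)))" by simp
    also have "\<dots> \<le> C * (exp k * fact N / k ^ N)"
      by (intro mult_left_mono poly_exp_bounded k T C)
    finally show ?thesis by (simp add: T_def y_def)
  qed
  then show "\<exists>C. \<forall>x\<in>carrier_vec (2 * p + q).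
      (1 + (\<Sum>i<2 * p + q. \<bar>real_of_int (vec_index x i)\<bar>)) ^ N * cmod (a (embed p q \<Phi> x)) \<le> C" by blast
qed

lemma lattice_inner_eq:
  assumes "h \<in> lattice_pts p q \<Phi>"
  shows "D_inner p q \<Phi> (gauss_fun p q \<Omega>) (gauss_fun p q \<Omega>) h =
    of_real (1 / sqrt (2 ^ p * Determinant.det (map_mat Im \<Omega>))) * coeff h"
proof -
  obtain x where x: "h = embed p q \<Phi> x" using assms unfolding lattice_pts_def by blast
  obtain w1 w2 m r where h: "h = (w1, w2, m, r)" by (cases h)
  have "w1 \<in> carrier_vec p" "w2 \<in> carrier_vec p" "m \<in> carrier_vec q" "r \<in> carrier_vec q"
    using x unfolding h embed_def Let_def by simp_all
  from L2_inner_gauss[OF this] show ?thesis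
    unfolding D_inner_def series_apply using assms by (simp add: h coeff_def)
qed

end

section \<open>The series for the quantum theta function\<close>

theorem proposition4:
  fixes p q :: nat and \<Omega> :: "complex mat" and \<Phi> :: "real mat"
    and Theta :: "point \<Rightarrow> complex"
  assumes "even q"
    and "\<Omega> \<in> carrier_mat p p"
    and "transpose_mat \<Omega> = \<Omega>"
    and "pos_def_mat p (map_mat Im \<Omega>)"
    and "lattice_embedding p q \<Phi>"
    and "(\<lambda>h. complex_of_real (1 / sqrt (2 ^ p * Determinant.det (map_mat Im \<Omega>))) * Theta h)
           = D_inner p q \<Phi> (gauss_fun p q \<Omega>) (gauss_fun p q \<Omega>)"
  shows "Theta \<in> carrier (schwartz_algebra p q \<Phi>)
    \<and> Theta = series (lattice_pts p q \<Phi>)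
        (\<lambda>h. b_tilde q h * exp (- (pi / 2) * herm_form \<Omega> (underline_w \<Omega> h) (underline_w \<Omega> h)))"
proof -
  interpret theta_data p q \<Omega> using assms(1-4) by unfold_locales
  let ?K = "complex_of_real (1 / sqrt (2 ^ p * Determinant.det (map_mat Im \<Omega>)))"
  have "Determinant.det (map_mat Im \<Omega>) > 0"
    unfolding Y_mat by (rule posdef_det_pos[OF Y_posdef])
  \<comment> \<open>The defining equation can be divided by this constant, so it determines
    \<open>Theta\<close> at every point.\<close>
  then have K: "?K \<noteq> 0" by simp
  have eq: "?K * Theta h = D_inner p q \<Phi> (gauss_fun p q \<Omega>) (gauss_fun p q \<Omega>) h" for h
    using assms(6) by (rule fun_cong)
  have on: "Theta h = coeff h" if "h \<in> lattice_pts p q \<Phi>" for h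
    using eq[of h] K unfolding lattice_inner_eq[OF that] by simp
  \<comment> \<open>The inner product is a series over the lattice and hence zero off it, which
    gives the support condition of the algebra.\<close>
  have off: "Theta h = 0" if "h \<notin> lattice_pts p q \<Phi>" for h
    using eq[of h] K that unfolding D_inner_def series_apply by simp
  have "rapidly_decreasing p q \<Phi> Theta"
    by (rule coeff_decreasing[OF assms(5) on])
  then have "Theta \<in> carrier (schwartz_algebra p q \<Phi>)"
    by (simp add: schwartz_algebra_def off)
  moreover have "Theta = series (lattice_pts p q \<Phi>) coeff"
    by (rule ext) (simp add: series_apply on off)
  ultimately show ?thesis unfolding coeff_def by blast
qed

end
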